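(* Let $K$ be a field and let $M,N$ be monomial ideals of finite colength in $K[x,y]$ with the same Hilbert function with respect to a positive $\mathbb{Z}^2/\mathbb{Z}\mathbf{c}$-grading, with $M>N$. The ideal of the edge-scheme $E(M,N)$, as a closed subscheme of the affine space $C_{\prec}(M)\times C_{\prec^{\mathrm{opp}}}(N)\cong \mathrm{Spec}\,K[T_+(M),T_-(N)]$, is generated by polynomials $F_{n,s}\in K[T_+(M),T_-(N)]$ with integer coefficients, where $n$ ranges over the minimal generators of $N$ and $s$ over the standard monomials of $M$ (monomials not in $M$) with $\deg(s)=\deg(n)$.
   Context: Grading: $\mathbf{c}=(\beta,-\alpha)$ with $\alpha,\beta$ relatively prime positive integers, $\deg(x)=\alpha$, $\deg(y)=\beta$, and $r=x^{\beta}y^{-\alpha}$. $\prec$ is the lexicographic order with $x\prec y$, and $\prec^{\mathrm{opp}}$ the lexicographic order with $y\prec^{\mathrm{opp}} x$. $\mathbb{H}_{\mathbf{c}}(H)$ is the multigraded Hilbert scheme of homogeneous ideals $I$ in $K[x,y]$ with $\dim_K(K[x,y]/I)_a=H(a)$ for all $a$, where $H$ is the common Hilbert function of $M$ and $N$. For monomial ideals in $\mathbb{H}_{\mathbf{c}}(H)$, $M>N$ means there is a degree-preserving bijection $f$ from the monomials of $M$ to the monomials of $N$ with $m\succeq f(m)$ for all $m$. $C_{\prec}(M)=\{I\in\mathbb{H}_{\mathbf{c}}(H):\mathrm{in}_{\prec}(I)=M\}$, a subscheme of $\mathbb{H}_{\mathbf{c}}(H)$, and similarly $C_{\prec^{\mathrm{opp}}}(N)$.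 The edge-scheme is the scheme-theoretic intersection $E(M,N)=C_{\prec}(M)\cap C_{\prec^{\mathrm{opp}}}(N)=C_{\prec}(M)\times_{\mathbb{H}_{\mathbf{c}}(H)}C_{\prec^{\mathrm{opp}}}(N)$. Coordinates: let $m_0=x^{a_0}\prec m_1=x^{a_1}y^{b_1}\prec\dots\prec m_e=y^{b_e}$ be the minimal generators of $M$ and $w_i=\mathrm{lcm}(m_{i-1},m_i)$ for $1\le i\le e$. $T_+(M)$ is the set of pairs $c_i^{\ell}=(m_i,\ell)$, $1\le i\le e$, $\ell\in\mathbb{Z}_{>0}$, such that $m_ir^{\ell}$ is a monomial not in $M$ and $w_ir^{\ell}\in M$. For a monomial $m\in M$ let $j(m)=\max\{j: m_j\mid m\}$. Put $f_0=m_0$ and recursively $$f_i=\frac{m_i}{m_{i-1}}f_{i-1}+\sum_{c_i^{\ell}\in T_+(M)}c_i^{\ell}\,\frac{m_ir^{\ell}}{m_{j(w_ir^{\ell})}}\,f_{j(w_ir^{\ell})}\in K[T_+(M)][x,y],$$ where the elements of $T_+(M)$ are regarded as variables, and $I_{\prec}(M)=\langle f_0,\dots,f_e\rangle$. By a theorem of Evain, the map $\mathrm{Spec}\,K[T_+(M)]\to\mathbb{H}_{\mathbf{c}}(H)$ induced by $I_{\prec}(M)$ is an isomorphism onto $C_{\prec}(M)$. Exchanging the roles of $x$ and $y$ (so $\prec$ becomes $\prec^{\mathrm{opp}}$ and $r$ becomes $r^{-1}$), one gets for $N$, with minimal generators $n_0=y^{b}\prec^{\mathrm{opp}}n_1\prec^{\mathrm{opp}}\cdots$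 listed increasingly for $\prec^{\mathrm{opp}}$, the set $T_-(N)$ of pairs $\widetilde{c}_k^{\,\ell}=(n_k,\ell)$, $k\ge1$, $\ell\in\mathbb{Z}_{>0}$, such that $n_kr^{-\ell}$ is a monomial not in $N$ and $\mathrm{lcm}(n_{k-1},n_k)r^{-\ell}\in N$, the analogous ideal $I_{\prec^{\mathrm{opp}}}(N)$, and the identification $C_{\prec^{\mathrm{opp}}}(N)\cong\mathrm{Spec}\,K[T_-(N)]$. "Integer coefficients" means that the polynomials are images of polynomials in $\mathbb{Z}[T_+(M),T_-(N)]$. *)

theory Defs
  imports
    "HOL-Library.Poly_Mapping"
    "HOL-Library.Product_Plus"
    "HOL-Library.Product_Order"
    "HOL-Library.Infinite_Typeclass"
begin

section \<open>Polynomials in x and y\<close>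

text \<open>
  The pair (i,j) stands for the monomial x^i y^j. Multiplication of monomials is (+),
  divisibility is (<=) and lcm is sup, all componentwise. Laurent monomials are pairs of integers.
\<close>
type_synonym mon = "nat \<times> nat"
type_synonym 'r xy = "mon \<Rightarrow>\<^sub>0 'r"
type_synonym 'r laurent = "int \<times> int \<Rightarrow>\<^sub>0 'r"

abbreviation term_xy :: "'m \<Rightarrow> 'r \<Rightarrow> ('m \<Rightarrow>\<^sub>0 'r::zero)" where
  "term_xy m c \<equiv> Poly_Mapping.single m c"

abbreviation const_xy :: "'r \<Rightarrow> 'r::zero xy" where
  "const_xy c \<equiv> Poly_Mapping.single 0 c"

definition lmon :: "mon \<Rightarrow> int \<times> int" where
  "lmon m = (int (fst m), int (snd m))"

text \<open>Only applied to Laurent polynomials all of whose exponents are nonnegative.\<close>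
definition laurent_to_xy :: "'r::zero laurent \<Rightarrow> 'r xy" where
  "laurent_to_xy p = Poly_Mapping.map_key lmon p"

abbreviation is_ideal :: "'a::comm_ring_1 set \<Rightarrow> bool" where
  "is_ideal I \<equiv> module.subspace (*) I"

abbreviation ideal_gen :: "'a::comm_ring_1 set \<Rightarrow> 'a set" where
  "ideal_gen S \<equiv> module.span (*) S"

definition is_prime_ideal :: "'a::comm_ring_1 set \<Rightarrow> bool" where
  "is_prime_ideal P \<longleftrightarrow> is_ideal P \<and> 1 \<notin> P \<and> (\<forall>a b. a * b \<in> P \<longrightarrow> a \<in> P \<or> b \<in> P)"


section \<open>Grading and orders\<close>

text \<open>
  For coprime positive \<alpha>, \<beta> the group Z^2/Z(\<beta>,-\<alpha>) is identified with Z via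
  (i,j) |-> \<alpha> i + \<beta> j. Monomials only have nonnegative degrees, and the graded pieces of
  negative degree vanish.
\<close>
definition deg :: "nat \<Rightarrow> nat \<Rightarrow> mon \<Rightarrow> nat" where
  "deg \<alpha> \<beta> m = \<alpha> * fst m + \<beta> * snd m"

definition homogeneous_of :: "nat \<Rightarrow> nat \<Rightarrow> nat \<Rightarrow> 'r::zero xy \<Rightarrow> bool" where
  "homogeneous_of \<alpha> \<beta> a p \<longleftrightarrow> (\<forall>m\<in>Poly_Mapping.keys p. deg \<alpha> \<beta> m = a)"

definition hom_part :: "nat \<Rightarrow> nat \<Rightarrow> nat \<Rightarrow> 'r::comm_monoid_add xy \<Rightarrow> 'r xy" where
  "hom_part \<alpha> \<beta> a p =
     (\<Sum>m | m \<in> Poly_Mapping.keys p \<and> deg \<alpha> \<beta> m = a. term_xy m (Poly_Mapping.lookup p m))"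

definition homogeneous_ideal :: "nat \<Rightarrow> nat \<Rightarrow> 'r::comm_ring_1 xy set \<Rightarrow> bool" where
  "homogeneous_ideal \<alpha> \<beta> I \<longleftrightarrow> is_ideal I \<and> (\<forall>p\<in>I. \<forall>a. hom_part \<alpha> \<beta> a p \<in> I)"

text \<open>The lexicographic orders: \<open>lex\<close> has x smaller than y, \<open>lex_opp\<close> has y smaller than x.\<close>
definition lex :: "mon \<Rightarrow> mon \<Rightarrow> bool" where
  "lex u v \<longleftrightarrow> snd u < snd v \<or> snd u = snd v \<and> fst u < fst v"

definition lex_opp :: "mon \<Rightarrow> mon \<Rightarrow> bool" where
  "lex_opp u v \<longleftrightarrow> fst u < fst v \<or> fst u = fst v \<and> snd u < snd v"

text \<open>Exponent vectors of r and of its inverse.\<close>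
definition r_vec :: "nat \<Rightarrow> nat \<Rightarrow> int \<times> int" where
  "r_vec \<alpha> \<beta> = (int \<beta>, - int \<alpha>)"

definition r_inv_vec :: "nat \<Rightarrow> nat \<Rightarrow> int \<times> int" where
  "r_inv_vec \<alpha> \<beta> = (- int \<beta>, int \<alpha>)"


section \<open>Monomial ideals\<close>

definition mons :: "'r::comm_ring_1 xy set \<Rightarrow> mon set" where
  "mons I = {m. term_xy m 1 \<in> I}"

definition monomial_ideal :: "'k::field xy set \<Rightarrow> bool" where
  "monomial_ideal I \<longleftrightarrow> (\<exists>S. I = ideal_gen ((\<lambda>m. term_xy m 1) ` S))"

definition finite_colength :: "'k::field xy set \<Rightarrow> bool" where
  "finite_colength I \<longleftrightarrow>
     (\<exists>B. finite B \<and> (\<forall>p. \<exists>c. p - (\<Sum>b\<in>B. const_xy (c b) * b) \<in> I))"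

text \<open>\<open>vs\<close> represents a basis of the degree \<open>a\<close> piece of K[x,y]/I, so its length is the dimension.\<close>
definition graded_basis :: "nat \<Rightarrow> nat \<Rightarrow> 'k::field xy set \<Rightarrow> nat \<Rightarrow> 'k xy list \<Rightarrow> bool" where
  "graded_basis \<alpha> \<beta> I a vs \<longleftrightarrow>
     (\<forall>v\<in>set vs. homogeneous_of \<alpha> \<beta> a v) \<and>
     (\<forall>p. homogeneous_of \<alpha> \<beta> a p \<longrightarrow>
        (\<exists>c. p - (\<Sum>i<length vs. const_xy (c i) * vs ! i) \<in> I)) \<and>
     (\<forall>c. (\<Sum>i<length vs. const_xy (c i) * vs ! i) \<in> I \<longrightarrow> (\<forall>i<length vs. c i = 0))"

definition has_hilbert_function :: "nat \<Rightarrow> nat \<Rightarrow> 'k::field xy set \<Rightarrow> (nat \<Rightarrow> nat) \<Rightarrow> bool" where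
  "has_hilbert_function \<alpha> \<beta> I H \<longleftrightarrow> (\<forall>a. \<exists>vs. length vs = H a \<and> graded_basis \<alpha> \<beta> I a vs)"

text \<open>The relation M > N, on the sets of monomials of the two ideals.\<close>
definition dominates :: "nat \<Rightarrow> nat \<Rightarrow> mon set \<Rightarrow> mon set \<Rightarrow> bool" where
  "dominates \<alpha> \<beta> M N \<longleftrightarrow>
     (\<exists>f. bij_betw f M N \<and>
        (\<forall>m\<in>M. deg \<alpha> \<beta> (f m) = deg \<alpha> \<beta> m \<and> (f m = m \<or> lex (f m) m)))"

definition mingens :: "mon set \<Rightarrow> mon set" where
  "mingens M = {m \<in> M. \<forall>u\<in>M. u \<le> m \<longrightarrow> u = m}"


section \<open>Evain's families\<close>

text \<open>
  In this section \<open>M\<close> is the set of monomials of a monomial ideal. Everything is parametrised by a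
  monomial order and an exponent vector \<open>r\<close>: the pair \<open>lex\<close>, \<open>r_vec\<close> gives the family over the cell
  of \<open>lex\<close>, and \<open>lex_opp\<close>, \<open>r_inv_vec\<close> the one with the roles of x and y exchanged.
\<close>
definition gens :: "(mon \<Rightarrow> mon \<Rightarrow> bool) \<Rightarrow> mon set \<Rightarrow> mon list" where
  "gens lt M = (THE ms. set ms = mingens M \<and> sorted_wrt lt ms \<and> distinct ms)"

definition rpow :: "int \<times> int \<Rightarrow> nat \<Rightarrow> int \<times> int" where
  "rpow r l = (int l * fst r, int l * snd r)"

definition arrows :: "(mon \<Rightarrow> mon \<Rightarrow> bool) \<Rightarrow> int \<times> int \<Rightarrow> mon set \<Rightarrow> (mon \<times> nat) set" where
  "arrows lt r M =
     {(gens lt M ! i, l) | i l. 1 \<le> i \<and> i < length (gens lt M) \<and> 0 < l \<and>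
        lmon (gens lt M ! i) + rpow r l \<in> range lmon - lmon ` M \<and>
        lmon (sup (gens lt M ! (i - 1)) (gens lt M ! i)) + rpow r l \<in> lmon ` M}"

definition last_div :: "(mon \<Rightarrow> mon \<Rightarrow> bool) \<Rightarrow> mon set \<Rightarrow> int \<times> int \<Rightarrow> nat" where
  "last_div lt M u = Max {j. j < length (gens lt M) \<and> lmon (gens lt M ! j) \<le> u}"

text \<open>
  The quotients of monomials in the recursion are Laurent monomials in general, although the result
  has nonnegative exponents. The guard \<open>j < Suc i\<close> always holds for the orders and vectors above; it
  only serves termination.
\<close>
fun evain_f :: "(mon \<Rightarrow> mon \<Rightarrow> bool) \<Rightarrow> int \<times> int \<Rightarrow> mon set \<Rightarrow> (mon \<times> nat \<Rightarrow> 'r::comm_ring_1) \<Rightarrow>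
    nat \<Rightarrow> 'r laurent" where
  "evain_f lt r M c 0 = term_xy (lmon (gens lt M ! 0)) 1"
| "evain_f lt r M c (Suc i) =
     term_xy (lmon (gens lt M ! Suc i) - lmon (gens lt M ! i)) 1 * evain_f lt r M c i +
     (\<Sum>l | (gens lt M ! Suc i, l) \<in> arrows lt r M.
        (let j = last_div lt M (lmon (sup (gens lt M ! i) (gens lt M ! Suc i)) + rpow r l)
         in term_xy (lmon (gens lt M ! Suc i) + rpow r l - lmon (gens lt M ! j))
              (c (gens lt M ! Suc i, l)) *
            (if j < Suc i then evain_f lt r M c j else 0)))"

text \<open>Variables: \<open>Inl\<close> for T_+(M), \<open>Inr\<close> for T_-(N).\<close>
type_synonym evar = "(mon \<times> nat) + (mon \<times> nat)"
type_synonym ('v, 'k) mpoly = "('v \<Rightarrow>\<^sub>0 nat) \<Rightarrow>\<^sub>0 'k"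

definition mvar :: "'v \<Rightarrow> ('v, 'k::comm_ring_1) mpoly" where
  "mvar v = Poly_Mapping.single (Poly_Mapping.single v 1) 1"

definition edge_vars :: "nat \<Rightarrow> nat \<Rightarrow> mon set \<Rightarrow> mon set \<Rightarrow> evar set" where
  "edge_vars \<alpha> \<beta> M N =
     Inl ` arrows lex (r_vec \<alpha> \<beta>) M \<union> Inr ` arrows lex_opp (r_inv_vec \<alpha> \<beta>) N"

text \<open>The polynomial ring in the variables \<open>V\<close>, inside the polynomials in all variables.\<close>
definition polys_in :: "'v set \<Rightarrow> ('v, 'k::comm_ring_1) mpoly set" where
  "polys_in V = {p. \<forall>e\<in>Poly_Mapping.keys p. Poly_Mapping.keys e \<subseteq> V}"

definition ideal_of_polys_in :: "'v set \<Rightarrow> ('v, 'k::comm_ring_1) mpoly set \<Rightarrow> bool" where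
  "ideal_of_polys_in V J \<longleftrightarrow> J \<subseteq> polys_in V \<and> 0 \<in> J \<and> (\<forall>p\<in>J. \<forall>q\<in>J. p + q \<in> J) \<and>
     (\<forall>p\<in>J. \<forall>q\<in>polys_in V. q * p \<in> J)"

definition ideal_gen_in :: "'v set \<Rightarrow> ('v, 'k::comm_ring_1) mpoly set \<Rightarrow> ('v, 'k) mpoly set" where
  "ideal_gen_in V B =
     {(\<Sum>p\<in>S. q p * p) | S q. finite S \<and> S \<subseteq> B \<and> (\<forall>p\<in>S. q p \<in> polys_in V)}"

definition eval_mpoly :: "('k \<Rightarrow> 'r) \<Rightarrow> ('v \<Rightarrow> 'r) \<Rightarrow> ('v, 'k::comm_ring_1) mpoly \<Rightarrow> 'r::comm_ring_1" where
  "eval_mpoly h t p =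
     (\<Sum>e\<in>Poly_Mapping.keys p. h (Poly_Mapping.lookup p e) *
        (\<Prod>v\<in>Poly_Mapping.keys e. t v ^ Poly_Mapping.lookup e v))"

text \<open>The generators f_0, ..., f_e of the universal ideals, over the ring in the variables \<open>evar\<close>.\<close>
definition family_plus :: "nat \<Rightarrow> nat \<Rightarrow> mon set \<Rightarrow> (evar, 'k::comm_ring_1) mpoly xy set" where
  "family_plus \<alpha> \<beta> M =
     {laurent_to_xy (evain_f lex (r_vec \<alpha> \<beta>) M (\<lambda>v. mvar (Inl v)) i) | i. i < length (gens lex M)}"

definition family_minus :: "nat \<Rightarrow> nat \<Rightarrow> mon set \<Rightarrow> (evar, 'k::comm_ring_1) mpoly xy set" where
  "family_minus \<alpha> \<beta> N =
     {laurent_to_xy (evain_f lex_opp (r_inv_vec \<alpha> \<beta>) N (\<lambda>v. mvar (Inr v)) i) | i.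
        i < length (gens lex_opp N)}"


section \<open>Points of the Hilbert scheme, of the cells and of the edge-scheme\<close>

text \<open>
  Schemes over K are handled through their points with values in K-algebras. A K-algebra is written
  as A = R/\<aa>, with \<aa> an ideal of a K-algebra R that is a type. Ideals of A[x,y] are represented by
  their preimages, i.e. by the ideals of R[x,y] that contain \<aa>; two of them are equal iff their
  preimages are.

  The next definition says that the A-module (A[x,y]/I)_a is locally free of rank \<open>h\<close>. The primes of A
  are the primes of R containing \<aa>; each has to lie in some basic open set D(s) on which there is
  a basis. Membership of \<open>c i\<close> in \<aa> up to a power of \<open>s\<close> says that \<open>c i\<close> vanishes in A_s.
\<close>
definition locally_free_rank ::
    "nat \<Rightarrow> nat \<Rightarrow> 'r::comm_ring_1 set \<Rightarrow> 'r xy set \<Rightarrow> nat \<Rightarrow> nat \<Rightarrow> bool" where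
  "locally_free_rank \<alpha> \<beta> \<aa> I a h \<longleftrightarrow>
     (\<forall>P. is_prime_ideal P \<and> \<aa> \<subseteq> P \<longrightarrow>
       (\<exists>s vs. s \<notin> P \<and> length vs = h \<and>
          (\<forall>v\<in>set vs. homogeneous_of \<alpha> \<beta> a v) \<and>
          (\<forall>p. homogeneous_of \<alpha> \<beta> a p \<longrightarrow>
             (\<exists>k c. const_xy (s ^ k) * p - (\<Sum>i<h. const_xy (c i) * vs ! i) \<in> I)) \<and>
          (\<forall>c. (\<Sum>i<h. const_xy (c i) * vs ! i) \<in> I \<longrightarrow> (\<forall>i<h. \<exists>k. s ^ k * c i \<in> \<aa>))))"

definition hilbert_points ::
    "nat \<Rightarrow> nat \<Rightarrow> (nat \<Rightarrow> nat) \<Rightarrow> 'r::comm_ring_1 set \<Rightarrow> 'r xy set set" where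
  "hilbert_points \<alpha> \<beta> H \<aa> =
     {I. homogeneous_ideal \<alpha> \<beta> I \<and> const_xy ` \<aa> \<subseteq> I \<and> (\<forall>a. locally_free_rank \<alpha> \<beta> \<aa> I a (H a))}"

text \<open>
  Generated by all leading terms \<open>c m\<close> of elements \<open>c m + q\<close> of \<open>I\<close>, where \<open>q\<close> only involves smaller
  monomials.
\<close>
definition initial_ideal :: "(mon \<Rightarrow> mon \<Rightarrow> bool) \<Rightarrow> 'r::comm_ring_1 xy set \<Rightarrow> 'r xy set" where
  "initial_ideal lt I =
     ideal_gen {term_xy m c | m c. \<exists>q. (\<forall>u\<in>Poly_Mapping.keys q. lt u m) \<and> term_xy m c + q \<in> I}"

definition cell_points ::
    "(mon \<Rightarrow> mon \<Rightarrow> bool) \<Rightarrow> nat \<Rightarrow> nat \<Rightarrow> (nat \<Rightarrow> nat) \<Rightarrow> mon set \<Rightarrow> 'r::comm_ring_1 set \<Rightarrow> 'r xy set set"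
  where
  "cell_points lt \<alpha> \<beta> H M \<aa> =
     {I \<in> hilbert_points \<alpha> \<beta> H \<aa>.
        initial_ideal lt I = ideal_gen ((\<lambda>m. term_xy m 1) ` M \<union> const_xy ` \<aa>)}"

text \<open>
  The extension to A[x,y] of the ideal generated by \<open>G\<close>, along the map of coefficient rings \<open>\<theta>\<close>.
\<close>
definition pullback_ideal :: "('b \<Rightarrow> 'r) \<Rightarrow> 'r set \<Rightarrow> 'b::zero xy set \<Rightarrow> 'r::comm_ring_1 xy set" where
  "pullback_ideal \<theta> \<aa> G = ideal_gen (Poly_Mapping.map \<theta> ` G \<union> const_xy ` \<aa>)"

text \<open>
  An A-point of Spec K[T_+(M),T_-(N)] is given by the values of the coordinates, i.e. by
  representatives \<open>t\<close> of elements of A. Under the coordinates on the two cells it is a pair of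
  A-points of the cells, and it belongs to the fibre product over the Hilbert scheme iff the two
  ideals coincide.
\<close>
definition edge_points :: "('k \<Rightarrow> 'r) \<Rightarrow> nat \<Rightarrow> nat \<Rightarrow> (nat \<Rightarrow> nat) \<Rightarrow> 'k::field xy set \<Rightarrow> 'k xy set \<Rightarrow>
    'r::comm_ring_1 set \<Rightarrow> (evar \<Rightarrow> 'r) set" where
  "edge_points h \<alpha> \<beta> H M N \<aa> =
     {t. let I = pullback_ideal (eval_mpoly h t) \<aa> (family_plus \<alpha> \<beta> (mons M));
             I' = pullback_ideal (eval_mpoly h t) \<aa> (family_minus \<alpha> \<beta> (mons N))
         in I \<in> cell_points lex \<alpha> \<beta> H (mons M) \<aa> \<and>
            I' \<in> cell_points lex_opp \<alpha> \<beta> H (mons N) \<aa> \<and> I = I'}"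

text \<open>
  \<open>J\<close> is the ideal of the edge-scheme: an A-point of the affine space factors through the closed
  subscheme defined by \<open>J\<close> iff it is a point of the edge-scheme. Here A runs through the quotients
  of the polynomial ring over K in the variables \<open>'z\<close>, which are all K-algebras generated by at most
  |\<open>'z\<close>| elements. As \<open>'z\<close> is infinite, these include all K-algebras of finite type, in particular
  the coordinate rings of all closed subschemes of the affine space; hence \<open>J\<close> is unique.
\<close>
definition is_edge_ideal :: "'z::infinite itself \<Rightarrow> nat \<Rightarrow> nat \<Rightarrow> (nat \<Rightarrow> nat) \<Rightarrow>
    'k::field xy set \<Rightarrow> 'k xy set \<Rightarrow> (evar, 'k) mpoly set \<Rightarrow> bool" where
  "is_edge_ideal (_ :: 'z itself) \<alpha> \<beta> H M N J \<longleftrightarrow>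
     ideal_of_polys_in (edge_vars \<alpha> \<beta> (mons M) (mons N)) J \<and>
     (\<forall>(\<aa> :: ('z, 'k) mpoly set) t. is_ideal \<aa> \<longrightarrow>
        ((\<forall>p\<in>J. eval_mpoly (Poly_Mapping.single 0) t p \<in> \<aa>) \<longleftrightarrow>
         t \<in> edge_points (Poly_Mapping.single 0) \<alpha> \<beta> H M N \<aa>))"

definition int_image :: "('v, int) mpoly \<Rightarrow> ('v, 'k::comm_ring_1) mpoly" where
  "int_image p = Poly_Mapping.map of_int p"

end

theory Submission
  imports Defs "Jordan_Normal_Form.Determinant"
begin

text \<open>
  A point \<open>t\<close> of the affine space with coordinates \<open>T_+(M)\<close>, \<open>T_-(N)\<close> and values in a K-algebra A
  specialises the two families of Evain to ideals \<open>I\<close> and \<open>I'\<close> of A[x,y], and it lies on the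
  edge-scheme iff both ideals lie in their cells and \<open>I = I'\<close>.

  The ideals always lie in their cells. For a monomial \<open>m\<close> of \<open>M\<close> let \<open>m_j\<close> be the last minimal
  generator dividing \<open>m\<close>, and put \<open>G_m = (m/m_j) f_j\<close>. The leading term of \<open>G_m\<close> is \<open>m\<close> with
  coefficient 1, and the A-span of all \<open>G_m\<close> is closed under multiplication by \<open>x\<close> and \<open>y\<close>:
  a product with a variable is again some \<open>G_m'\<close>, except when it passes from one step of the staircase
  to the next, and there the recursion defining \<open>f_{j+1}\<close>, multiplied by a monomial, expresses it by
  elements \<open>G_m'\<close>. So the \<open>G_m\<close> form an A-basis of \<open>I\<close>, unitriangular with respect to the monomials
  (\<open>staircase.unitriangular\<close>). Therefore A[x,y]/I is free on the standard monomials of \<open>M\<close>, the initial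
  ideal of \<open>I\<close> is \<open>M\<close>, and \<open>I\<close> is a point of the cell (\<open>unitriangular_family.in_cell\<close>). The same
  holds for \<open>I'\<close> and \<open>N\<close>.

  In each degree \<open>a\<close> the quotients by \<open>I\<close> and by \<open>I'\<close> are thus free of the same finite rank
  \<open>H(a)\<close>. If \<open>I'\<close> is contained in \<open>I\<close>, the induced surjection between them is an isomorphism, because a
  square matrix with a one-sided inverse over a commutative ring has a two-sided one. Consequently
  \<open>I' \<subseteq> I\<close> already implies \<open>I = I'\<close> (\<open>cell_ideals_eq_of_subset\<close>).

  The inclusion can be tested on the generators \<open>g_n\<close> of \<open>I'\<close>, which are indexed by the minimal
  generators \<open>n\<close> of \<open>N\<close> and are homogeneous of degree \<open>deg n\<close>. Reducing \<open>g_n\<close> modulo the \<open>G_m\<close> leaves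
  a combination of standard monomials \<open>s\<close> of \<open>M\<close> of the same degree. As all leading coefficients are 1,
  this division can be carried out over the integers with indeterminate coordinates; \<open>F_{n,s}\<close> is the
  coefficient of \<open>s\<close>. The division is compatible with specialisation at \<open>t\<close>, and standard monomials
  are independent modulo \<open>I\<close>, so \<open>g_n\<close> lies in \<open>I\<close> at the point \<open>t\<close> iff all \<open>F_{n,s}\<close> vanish there.
\<close>

section \<open>Ideals and polynomials as modules\<close>

abbreviation coef :: "('m \<Rightarrow>\<^sub>0 'r::zero) \<Rightarrow> 'm \<Rightarrow> 'r" where
  "coef \<equiv> Poly_Mapping.lookup"

abbreviation supp :: "('m \<Rightarrow>\<^sub>0 'r::zero) \<Rightarrow> 'm set" where
  "supp \<equiv> Poly_Mapping.keys"

lemma ideal_module: "Modules.module ((*) :: 'a::comm_ring_1 \<Rightarrow> _)"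
  by unfold_locales (simp_all add: algebra_simps)

lemmas ideal_zero = Modules.module.subspace_0[OF ideal_module]
  and ideal_add = Modules.module.subspace_add[OF ideal_module]
  and ideal_diff = Modules.module.subspace_diff[OF ideal_module]
  and ideal_sum = Modules.module.subspace_sum[OF ideal_module]
  and ideal_mult = Modules.module.subspace_scale[OF ideal_module]
  and ideal_gen_is_ideal = Modules.module.subspace_span[OF ideal_module]
  and ideal_gen_base = Modules.module.span_base[OF ideal_module]
  and ideal_gen_minimal = Modules.module.span_minimal[OF ideal_module]

text \<open>
  Besides ideals, spans over the coefficient ring are needed: the basis of an ideal of A[x,y] that is
  constructed below spans it over A.
\<close>
abbreviation scal :: "'r::comm_ring_1 \<Rightarrow> ('m::comm_monoid_add \<Rightarrow>\<^sub>0 'r) \<Rightarrow> ('m \<Rightarrow>\<^sub>0 'r)" where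
  "scal c p \<equiv> term_xy 0 c * p"

lemma coeff_module: "Modules.module scal"
  by unfold_locales (simp_all add: algebra_simps single_add mult_single flip: mult.assoc)

abbreviation coeff_span :: "('m::comm_monoid_add \<Rightarrow>\<^sub>0 'r::comm_ring_1) set \<Rightarrow> ('m \<Rightarrow>\<^sub>0 'r) set" where
  "coeff_span \<equiv> Modules.module.span scal"

lemmas coeff_span_zero = Modules.module.span_zero[OF coeff_module]
  and coeff_span_add = Modules.module.span_add[OF coeff_module]
  and coeff_span_diff = Modules.module.span_diff[OF coeff_module]
  and coeff_span_sum = Modules.module.span_sum[OF coeff_module]
  and coeff_span_scale = Modules.module.span_scale[OF coeff_module]
  and coeff_span_base = Modules.module.span_base[OF coeff_module]
  and coeff_span_mono = Modules.module.span_mono[OF coeff_module]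
  and coeff_span_induct = Modules.module.span_induct_alt[OF coeff_module, consumes 1, case_names zero step]

lemma coef_term_mult:
  fixes f :: "'m::ab_group_add \<Rightarrow>\<^sub>0 'r::comm_ring_1"
  shows "coef (term_xy d c * f) u = c * coef f (u - d)"
proof -
  have *: "\<And>q. (u = d + q) = (q = u - d)" by (auto simp: algebra_simps)
  show ?thesis
    by (simp add: lookup_mult lookup_single when_mult *)
qed

lemma coef_const_mult:
  fixes f :: "'m::comm_monoid_add \<Rightarrow>\<^sub>0 'r::comm_ring_1"
  shows "coef (term_xy 0 c * f) u = c * coef f u"
  by (simp add: lookup_mult lookup_single when_mult)

lemma coef_term_mult_xy:
  fixes f :: "'r::comm_ring_1 xy"
  shows "coef (term_xy d c * f) u = (if d \<le> u then c * coef f (u - d) else 0)"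
proof -
  have *: "\<And>q. (u = d + q) = (d \<le> u \<and> q = u - d)"
    by (auto simp: less_eq_prod_def prod_eq_iff)
  show ?thesis
    by (simp add: lookup_mult lookup_single when_mult * flip: when_when)
qed

lemma sum_of_terms:
  fixes p :: "'m \<Rightarrow>\<^sub>0 'r::comm_monoid_add"
  assumes "finite A" "supp p \<subseteq> A"
  shows "p = (\<Sum>u\<in>A. term_xy u (coef p u))"
proof (rule poly_mapping_eqI)
  fix k
  have "coef (\<Sum>u\<in>A. term_xy u (coef p u)) k = (\<Sum>u\<in>A. if u = k then coef p u else 0)"
    by (simp add: lookup_sum lookup_single when_def cong: if_cong)
  also have "\<dots> = coef p k"
    using assms by (auto simp: in_keys_iff)
  finally show "coef p k = coef (\<Sum>u\<in>A. term_xy u (coef p u)) k" by simp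
qed

lemma poly_mapping_term_induct [case_names zero single add]:
  assumes "P 0" "\<And>u c. P (term_xy u c)" "\<And>p q. P p \<Longrightarrow> P q \<Longrightarrow> P (p + q)"
  shows "P (p :: 'm \<Rightarrow>\<^sub>0 'r::comm_monoid_add)"
proof -
  have "P (\<Sum>u\<in>A. term_xy u (c u))" if "finite A" for A c
    using that by induction (auto intro: assms)
  from this[of "supp p" "coef p"] show ?thesis
    by (simp flip: sum_of_terms[of "supp p" p])
qed

lemma lookup_map_hom: "\<theta> 0 = 0 \<Longrightarrow> coef (Poly_Mapping.map \<theta> p) u = \<theta> (coef p u)"
  by (simp add: Poly_Mapping.map.rep_eq when_def)

lemma coef_laurent_to_xy: "coef (laurent_to_xy p) u = coef p (lmon u)"
proof -
  have "inj lmon" by (auto simp: inj_def lmon_def prod_eq_iff)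
  then show ?thesis by (simp add: laurent_to_xy_def Poly_Mapping.map_key.rep_eq)
qed

section \<open>Change of coefficients and evaluation\<close>

locale ring_map =
  fixes \<theta> :: "'a::comm_ring_1 \<Rightarrow> 'b::comm_ring_1"
  assumes one: "\<theta> 1 = 1" and plus: "\<theta> (x + y) = \<theta> x + \<theta> y" and times: "\<theta> (x * y) = \<theta> x * \<theta> y"
begin

sublocale additive \<theta> by unfold_locales (rule plus)

lemma map_zero: "Poly_Mapping.map \<theta> 0 = 0"
  by (rule poly_mapping_eqI) (simp add: lookup_map_hom zero)

lemma map_plus: "Poly_Mapping.map \<theta> (p + q) = Poly_Mapping.map \<theta> p + Poly_Mapping.map \<theta> q"
  by (rule poly_mapping_eqI) (simp add: lookup_map_hom zero lookup_add plus)

lemma map_sum: "Poly_Mapping.map \<theta> (sum g A) = (\<Sum>x\<in>A. Poly_Mapping.map \<theta> (g x))"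
  by (rule poly_mapping_eqI) (simp add: lookup_map_hom zero lookup_sum sum)

lemma map_times:
  fixes p q :: "'m::comm_monoid_add \<Rightarrow>\<^sub>0 'a"
  shows "Poly_Mapping.map \<theta> (p * q) = Poly_Mapping.map \<theta> p * Poly_Mapping.map \<theta> q"
proof (induction p rule: poly_mapping_term_induct)
  case (single u c)
  show ?case
    by (induction q rule: poly_mapping_term_induct)
      (simp_all add: mult_single zero times distrib_left map_plus map_zero map_single)
qed (simp_all add: distrib_right map_plus map_zero)

lemma map_term: "Poly_Mapping.map \<theta> (term_xy u c) = term_xy u (\<theta> c)"
  by (simp add: zero map_single)

end

definition eval_monom :: "('v \<Rightarrow> 'r::comm_ring_1) \<Rightarrow> ('v \<Rightarrow>\<^sub>0 nat) \<Rightarrow> 'r" where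
  "eval_monom t e = (\<Prod>v\<in>supp e. t v ^ coef e v)"

lemma eval_monom_add: "eval_monom t (d + e) = eval_monom t d * eval_monom t e"
proof -
  have ext: "eval_monom t e = (\<Prod>v\<in>A. t v ^ coef e v)" if "finite A" "supp e \<subseteq> A" for A e
    unfolding eval_monom_def by (rule prod.mono_neutral_left) (use that in \<open>auto simp: in_keys_iff\<close>)
  let ?A = "supp d \<union> supp e"
  have "supp (d + e) \<subseteq> ?A" by (rule Poly_Mapping.keys_add)
  then show ?thesis
    by (simp add: ext[of ?A] lookup_add power_add prod.distrib)
qed

text \<open>
  On a single term the evaluation is multiplicative because it turns sums of exponents into products;
  additivity then extends this to all polynomials.
\<close>
lemma (in ring_map) eval_ring_map: "ring_map (eval_mpoly \<theta> t)"
proof -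
  have ev: "eval_mpoly \<theta> t p = (\<Sum>e\<in>supp p. \<theta> (coef p e) * eval_monom t e)" for p
    by (simp add: eval_mpoly_def eval_monom_def)
  have add: "eval_mpoly \<theta> t (p + q) = eval_mpoly \<theta> t p + eval_mpoly \<theta> t q" for p q
    unfolding ev
    by (rule setsum_keys_plus_distrib) (simp_all add: zero plus distrib_right)
  have eval_term: "eval_mpoly \<theta> t (term_xy e c) = \<theta> c * eval_monom t e" for e c
    by (simp add: ev zero)
  have mult: "eval_mpoly \<theta> t (p * q) = eval_mpoly \<theta> t p * eval_mpoly \<theta> t q" for p q
  proof (induction p rule: poly_mapping_term_induct)
    case (single u c)
    show ?case
    proof (induction q rule: poly_mapping_term_induct)
      case (single u' c')
      show ?case
        by (simp add: mult_single eval_term times eval_monom_add algebra_simps)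
    qed (simp_all add: distrib_left add ev[of 0])
  qed (simp_all add: distrib_right add ev[of 0])
  have "eval_mpoly \<theta> t 1 = 1"
    using eval_term[of 0 1] by (simp add: one eval_monom_def)
  with add mult show ?thesis by unfold_locales
qed

lemma (in ring_map) eval_mvar: "eval_mpoly \<theta> t (mvar v) = t v"
  by (simp add: eval_mpoly_def mvar_def one zero)

section \<open>One-sided inverses modulo an ideal\<close>

text \<open>
  Modulo \<open>I\<close> the matrix \<open>C\<close> has the left inverse \<open>B\<close>, so \<open>det B det C\<close> is 1 modulo \<open>I\<close>, and
  multiplying \<open>e C = 0\<close> with the adjugate of \<open>C\<close> gives \<open>det C e = 0\<close>. Congruences
  replace the quotient ring by \<open>I\<close> here, since the ideal is a value and not part of a type.
\<close>
lemma solution_in_ideal: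
  fixes B :: "'i \<Rightarrow> 'j \<Rightarrow> 'r::comm_ring_1" and C :: "'j \<Rightarrow> 'i \<Rightarrow> 'r"
  assumes I: "is_ideal I" and fin: "finite S" "finite T" and card: "card S = card T"
    and BC: "\<And>s s'. s \<in> S \<Longrightarrow> s' \<in> S \<Longrightarrow> (\<Sum>t\<in>T. B s t * C t s') - (if s = s' then 1 else 0) \<in> I"
    and eC: "\<And>s. s \<in> S \<Longrightarrow> (\<Sum>t\<in>T. e t * C t s) \<in> I"
    and t: "t \<in> T"
  shows "e t \<in> I"
proof -
  define n where "n = card S"
  obtain f where f: "bij_betw f {0..<n} S"
    using ex_bij_betw_nat_finite[OF fin(1)] n_def by auto
  obtain g where g: "bij_betw g {0..<n} T"
    using ex_bij_betw_nat_finite[OF fin(2)] n_def card by auto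
  have fS: "f i \<in> S" if "i < n" for i using f that by (auto simp: bij_betw_def)
  have fi: "f i = f j \<longleftrightarrow> i = j" if "i < n" "j < n" for i j
    using f that by (auto simp: bij_betw_def inj_on_def)
  have sumT: "(\<Sum>t\<in>T. h t) = (\<Sum>k=0..<n. h (g k))" for h :: "'j \<Rightarrow> 'r"
    by (rule sum.reindex_bij_betw[OF g, symmetric])
  define X where "X = mat n n (\<lambda>(i, j). B (f i) (g j))"
  define Y where "Y = mat n n (\<lambda>(i, j). C (g i) (f j))"
  have X: "X \<in> carrier_mat n n" and Y: "Y \<in> carrier_mat n n" by (auto simp: X_def Y_def)
  have XY: "(X * Y) $$ (i, j) - 1\<^sub>m n $$ (i, j) \<in> I" if "i < n" "j < n" for i j
    using BC[OF fS[OF that(1)] fS[OF that(2)]] that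
    by (simp add: X_def Y_def scalar_prod_def sumT fi)
  \<comment> \<open>Entrywise congruence passes to determinants through the Leibniz formula.\<close>
  have prod_cong: "prod a A - prod b A \<in> I" if "\<And>x. x \<in> A \<Longrightarrow> a x - b x \<in> I"
    for a b :: "nat \<Rightarrow> 'r" and A
    using that
  proof (induction A rule: infinite_finite_induct)
    case (insert x A)
    have "a x * prod a A - b x * prod b A = prod a A * (a x - b x) + b x * (prod a A - prod b A)"
      by (simp add: algebra_simps)
    with insert show ?case
      by (auto intro!: ideal_add[OF I] ideal_mult[OF I])
  qed (auto simp: ideal_zero[OF I])
  have "det (X * Y) - det (1\<^sub>m n) \<in> I"
  proof -
    have XYc: "X * Y \<in> carrier_mat n n" using X Y by simp
    show ?thesis
      unfolding det_def'[OF XYc] det_def'[OF one_carrier_mat] sum_subtractf[symmetric]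
        right_diff_distrib[symmetric]
    proof (intro ideal_sum[OF I] ideal_mult[OF I] prod_cong XY)
      fix p i assume "p \<in> {p. p permutes {0..<n}}" "i \<in> {0..<n}"
      then have "p i \<in> {0..<n}" by (simp add: permutes_in_image)
      then show "i < n" "p i < n" using \<open>i \<in> _\<close> by auto
    qed
  qed
  then have detI: "det X * det Y - 1 \<in> I" by (simp add: det_mult[OF X Y])
  obtain k where k: "k < n" "g k = t" using g t by (auto simp: bij_betw_def)
  define Z where "Z = adj_mat Y"
  have Z: "Z \<in> carrier_mat n n" "Y * Z = det Y \<cdot>\<^sub>m 1\<^sub>m n" using adj_mat[OF Y] by (auto simp: Z_def)
  have "(\<Sum>i=0..<n. (\<Sum>j=0..<n. e (g j) * Y $$ (j, i)) * Z $$ (i, k)) \<in> I"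
  proof (intro ideal_sum[OF I])
    fix i assume "i \<in> {0..<n}"
    then have "(\<Sum>j=0..<n. e (g j) * Y $$ (j, i)) \<in> I"
      using eC[OF fS[of i]] by (simp add: sumT Y_def)
    then show "(\<Sum>j=0..<n. e (g j) * Y $$ (j, i)) * Z $$ (i, k) \<in> I"
      by (subst mult.commute) (rule ideal_mult[OF I])
  qed
  also have "(\<Sum>i=0..<n. (\<Sum>j=0..<n. e (g j) * Y $$ (j, i)) * Z $$ (i, k))
      = (\<Sum>j=0..<n. e (g j) * (Y * Z) $$ (j, k))"
    using Y Z(1) k
    by (simp add: scalar_prod_def sum_distrib_left sum_distrib_right mult.assoc)
      (rule sum.swap)
  also have "\<dots> = (\<Sum>j=0..<n. if j = k then e (g j) * det Y else 0)"
    using k by (intro sum.cong) (auto simp: Z(2))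
  also have "\<dots> = e t * det Y" using k by simp
  finally have "e t * det Y \<in> I" .
  then have "det X * (e t * det Y) - e t * (det X * det Y - 1) \<in> I"
    using detI by (intro ideal_diff[OF I ideal_mult[OF I] ideal_mult[OF I]])
  then show ?thesis by (simp add: algebra_simps)
qed

section \<open>Degrees and homogeneous parts\<close>

definition is_subring :: "'r::comm_ring_1 set \<Rightarrow> bool" where
  "is_subring S \<longleftrightarrow> 0 \<in> S \<and> 1 \<in> S \<and> (\<forall>x\<in>S. \<forall>y\<in>S. x + y \<in> S \<and> x - y \<in> S \<and> x * y \<in> S)"

lemma is_subringD:
  assumes "is_subring S"
  shows "0 \<in> S" "1 \<in> S" "x \<in> S \<Longrightarrow> y \<in> S \<Longrightarrow> x + y \<in> S" "x \<in> S \<Longrightarrow> y \<in> S \<Longrightarrow> x * y \<in> S"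
    "x \<in> S \<Longrightarrow> - x \<in> S"
proof -
  show "0 \<in> S" "1 \<in> S" "x \<in> S \<Longrightarrow> y \<in> S \<Longrightarrow> x + y \<in> S" "x \<in> S \<Longrightarrow> y \<in> S \<Longrightarrow> x * y \<in> S"
    using assms by (auto simp: is_subring_def)
  show "- x \<in> S" if "x \<in> S"
    using assms that unfolding is_subring_def by (metis diff_0)
qed

lemma coef_sum_terms:
  assumes "finite S"
  shows "coef (\<Sum>s\<in>S. term_xy s (c s)) u = (if u \<in> S then c u else (0::'r::comm_monoid_add))"
proof -
  have "coef (\<Sum>s\<in>S. term_xy s (c s)) u = (\<Sum>s\<in>S. if s = u then c s else 0)"
    by (simp add: lookup_sum lookup_single when_def cong: if_cong)
  then show ?thesis using assms by simp
qed

lemma coef_hom_part: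
  "coef (hom_part \<alpha> \<beta> a p) u = (if deg \<alpha> \<beta> u = a then coef p u else (0::'r::comm_ring_1))"
  unfolding hom_part_def
  by (subst coef_sum_terms) (auto simp: in_keys_iff)

lemma homogeneous_hom_part: "homogeneous_of \<alpha> \<beta> a (hom_part \<alpha> \<beta> a (p :: 'r::comm_ring_1 xy))"
  by (auto simp: homogeneous_of_def in_keys_iff coef_hom_part split: if_splits)

lemma sum_hom_parts:
  fixes p :: "'r::comm_ring_1 xy"
  shows "p = (\<Sum>a\<in>deg \<alpha> \<beta> ` supp p. hom_part \<alpha> \<beta> a p)"
proof (rule poly_mapping_eqI)
  fix u
  show "coef p u = coef (\<Sum>a\<in>deg \<alpha> \<beta> ` supp p. hom_part \<alpha> \<beta> a p) u"
    by (auto simp: lookup_sum coef_hom_part in_keys_iff)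
qed

lemma finite_degree: "0 < \<alpha> \<Longrightarrow> 0 < \<beta> \<Longrightarrow> finite {u. deg \<alpha> \<beta> u = a}"
proof (rule finite_subset)
  assume "0 < \<alpha>" "0 < \<beta>"
  then have "i \<le> \<alpha> * i + \<beta> * j" "j \<le> \<alpha> * i + \<beta> * j" for i j :: nat
    by (simp_all add: trans_le_add1 trans_le_add2)
  then show "{u. deg \<alpha> \<beta> u = a} \<subseteq> {..a} \<times> {..a}"
    by (auto simp: deg_def)
qed simp

section \<open>Ideals with a unitriangular basis\<close>

text \<open>
  The division algorithm, the independence of standard monomials and the computation of the initial
  ideal rest on the existence of a family \<open>G\<close> of homogeneous polynomials with pairwise different leading
  monomials and leading coefficients 1 whose span over the coefficients is an ideal. Closure of the span
  takes the place of Buchberger's criterion; over a general coefficient ring it is also the form in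
  which it can be checked directly.
\<close>
locale unitriangular_family =
  fixes lt :: "mon \<Rightarrow> mon \<Rightarrow> bool" and \<alpha> \<beta> :: nat and M :: "mon set"
    and G :: "mon \<Rightarrow> 'r::comm_ring_1 xy"
  assumes pos: "0 < \<alpha>" "0 < \<beta>"
    and lt_irrefl: "\<not> lt u u"
    and lt_trans: "lt u v \<Longrightarrow> lt v w \<Longrightarrow> lt u w"
    and lt_total: "u \<noteq> v \<Longrightarrow> lt u v \<or> lt v u"
    and lt_wf: "wf {(u, v). lt u v}"
    and lead: "m \<in> M \<Longrightarrow> coef (G m) m = 1"
    and lower: "m \<in> M \<Longrightarrow> u \<in> supp (G m) \<Longrightarrow> u \<noteq> m \<Longrightarrow> lt u m"
    and same_degree: "m \<in> M \<Longrightarrow> u \<in> supp (G m) \<Longrightarrow> deg \<alpha> \<beta> u = deg \<alpha> \<beta> m"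
    and step_closed: "m \<in> M \<Longrightarrow> e \<in> {(1, 0), (0, 1)} \<Longrightarrow> term_xy e 1 * G m \<in> coeff_span (G ` M)"
begin

lemma term_closed:
  assumes "p \<in> coeff_span (G ` M)"
  shows "term_xy d c * p \<in> coeff_span (G ` M)"
proof -
  have step: "term_xy e 1 * q \<in> coeff_span (G ` M)"
    if "q \<in> coeff_span (G ` M)" "e \<in> {(1, 0), (0, 1)}" for q e
    using that(1)
  proof (induction rule: coeff_span_induct)
    case (step c x y)
    have "term_xy e 1 * (scal c x + y) = scal c (term_xy e 1 * x) + term_xy e 1 * y"
      by (simp add: algebra_simps)
    with step that(2) show ?case
      by (auto intro!: coeff_span_add coeff_span_scale step_closed)
  qed (simp add: coeff_span_zero)
  have x: "term_xy (i, 0) 1 * q \<in> coeff_span (G ` M)" if "q \<in> coeff_span (G ` M)" for q i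
  proof (induction i)
    case 0
    have "term_xy (0, 0) 1 * q = scal 1 q" by (simp only: zero_prod_def)
    with that show ?case by (simp add: coeff_span_scale)
  next
    case (Suc i)
    have "term_xy (Suc i, 0) 1 * q = term_xy (1, 0) 1 * (term_xy (i, 0) 1 * q)"
      by (simp add: mult_single flip: mult.assoc)
    with step[OF Suc] show ?case by simp
  qed
  have y: "term_xy (0, i) 1 * q \<in> coeff_span (G ` M)" if "q \<in> coeff_span (G ` M)" for q i
  proof (induction i)
    case 0
    have "term_xy (0, 0) 1 * q = scal 1 q" by (simp only: zero_prod_def)
    with that show ?case by (simp add: coeff_span_scale)
  next
    case (Suc i)
    have "term_xy (0, Suc i) 1 * q = term_xy (0, 1) 1 * (term_xy (0, i) 1 * q)"
      by (simp add: mult_single flip: mult.assoc)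
    with step[OF Suc] show ?case by simp
  qed
  have "term_xy d c * p = scal c (term_xy (fst d, 0) 1 * (term_xy (0, snd d) 1 * p))"
    by (simp add: mult_single flip: mult.assoc)
  then show ?thesis using coeff_span_scale[OF x[OF y[OF assms]]] by simp
qed

text \<open>
  Both the span of the \<open>G m\<close> and the polynomials with coefficients in \<open>\<aa>\<close> are closed under
  multiplication by terms, so the span on the right is already an ideal. In such combinations leading
  terms are visible.
\<close>
lemma ideal_eq_coeff_span:
  assumes "is_ideal \<aa>"
  shows "ideal_gen (G ` M \<union> const_xy ` \<aa>) = coeff_span (G ` M \<union> {term_xy u c | u c. c \<in> \<aa>})"
    (is "?I = ?W")
proof
  have mult: "term_xy d c * x \<in> ?W" if "x \<in> ?W" for d c x
    using that
  proof (induction rule: coeff_span_induct)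
    case (step k x y)
    have "term_xy d c * x \<in> ?W"
    proof (cases "x \<in> G ` M")
      case True
      then have "term_xy d c * x \<in> coeff_span (G ` M)" by (intro term_closed coeff_span_base)
      then show ?thesis by (rule subsetD[OF coeff_span_mono, rotated]) auto
    next
      case False
      with step obtain u c' where "x = term_xy u c'" "c' \<in> \<aa>" by auto
      then have "term_xy d c * x = term_xy (d + u) (c * c')" "c * c' \<in> \<aa>"
        by (simp_all add: mult_single ideal_mult[OF assms])
      then show ?thesis by (intro coeff_span_base UnI2) blast
    qed
    moreover have "term_xy d c * (scal k x + y) = scal k (term_xy d c * x) + term_xy d c * y"
      by (simp add: algebra_simps)
    ultimately show ?case using step by (auto intro!: coeff_span_add coeff_span_scale)
  qed (simp add: coeff_span_zero)
  have "is_ideal ?W"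
  proof (rule Modules.module.subspaceI[OF ideal_module])
    fix c x assume x: "x \<in> ?W"
    show "c * x \<in> ?W"
    proof (induction c rule: poly_mapping_term_induct)
      case (single d b)
      show ?case by (rule mult[OF x])
    qed (simp_all add: coeff_span_zero distrib_right coeff_span_add)
  qed (auto intro: coeff_span_zero coeff_span_add)
  moreover have "G ` M \<union> const_xy ` \<aa> \<subseteq> G ` M \<union> {term_xy u c | u c. c \<in> \<aa>}" by blast
  then have "G ` M \<union> const_xy ` \<aa> \<subseteq> ?W" by (blast intro: coeff_span_base)
  ultimately show "?I \<subseteq> ?W" by (intro ideal_gen_minimal)
  have "Modules.module.subspace scal ?I"
    by (rule Modules.module.subspaceI[OF coeff_module])
      (auto intro: ideal_zero ideal_add ideal_mult ideal_gen_is_ideal)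
  moreover have "term_xy u c \<in> ?I" if "c \<in> \<aa>" for u c
  proof -
    have "term_xy u 1 * const_xy c \<in> ?I"
      using that by (intro ideal_mult[OF ideal_gen_is_ideal] ideal_gen_base) auto
    then show ?thesis by (simp add: mult_single)
  qed
  ultimately show "?W \<subseteq> ?I"
    by (intro Modules.module.span_minimal[OF coeff_module]) (auto intro: ideal_gen_base)
qed

text \<open>
  Write \<open>p\<close> as a combination of the \<open>G m\<close> modulo \<open>\<aa>\<close> and discard the summands with coefficient in
  \<open>\<aa>\<close>. At the largest remaining index no other summand contributes, so nothing cancels there. The
  independence of standard monomials and the shape of the initial ideal both follow from this.
\<close>
lemma leading_monomial_in_M:
  assumes \<aa>: "is_ideal \<aa>" and p: "p \<in> ideal_gen (G ` M \<union> const_xy ` \<aa>)"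
    and not: "coef p v \<notin> \<aa>"
  shows "\<exists>m\<in>M. coef p m \<notin> \<aa> \<and> (\<forall>u. lt m u \<longrightarrow> coef p u \<in> \<aa>)"
proof -
  have "\<exists>T d. finite T \<and> T \<subseteq> M \<and> (\<forall>u. coef p u - (\<Sum>m\<in>T. d m * coef (G m) u) \<in> \<aa>)"
    using p unfolding ideal_eq_coeff_span[OF \<aa>]
  proof (induction rule: coeff_span_induct)
    case zero
    then show ?case by (intro exI[of _ "{}"]) (simp add: ideal_zero[OF \<aa>])
  next
    case (step c x y)
    from step(2) obtain T d where T: "finite T" "T \<subseteq> M"
      and d: "\<And>u. coef y u - (\<Sum>m\<in>T. d m * coef (G m) u) \<in> \<aa>"
      by blast
    show ?case
    proof (cases "x \<in> G ` M")
      case True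
      then obtain m where m: "m \<in> M" "x = G m" by auto
      define d' where "d' k = (if k \<in> T then d k else 0) + (if k = m then c else 0)" for k
      have "(\<Sum>k\<in>insert m T. d' k * coef (G k) u)
          = (\<Sum>k\<in>insert m T. if k \<in> T then d k * coef (G k) u else 0)
            + (\<Sum>k\<in>insert m T. if k = m then c * coef (G k) u else 0)" for u
        unfolding sum.distrib[symmetric] by (intro sum.cong) (auto simp: d'_def algebra_simps)
      moreover have "(\<Sum>k\<in>insert m T. if k \<in> T then d k * coef (G k) u else 0)
          = (\<Sum>k\<in>T. d k * coef (G k) u)" for u
        using T(1) by (intro sum.mono_neutral_cong_right) auto
      ultimately have "(\<Sum>k\<in>insert m T. d' k * coef (G k) u)
          = (\<Sum>k\<in>T. d k * coef (G k) u) + c * coef (G m) u" for u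
        using T(1) by simp
      then have "coef (scal c x + y) u - (\<Sum>k\<in>insert m T. d' k * coef (G k) u) \<in> \<aa>" for u
        using d[of u] m by (simp add: lookup_add coef_const_mult)
      then show ?thesis using T m by (intro exI[of _ "insert m T"] exI[of _ d']) auto
    next
      case False
      with step(1) obtain w b where x: "x = term_xy w b" "b \<in> \<aa>" by auto
      have "coef (scal c x + y) u - (\<Sum>k\<in>T. d k * coef (G k) u) \<in> \<aa>" for u
      proof -
        have "coef (scal c x) u \<in> \<aa>"
          using x by (auto simp: coef_const_mult lookup_single when_def
              intro: ideal_mult[OF \<aa>] ideal_zero[OF \<aa>])
        from ideal_add[OF \<aa> this d[of u]] show ?thesis by (simp add: lookup_add algebra_simps)
      qed
      then show ?thesis using T by blast
    qed
  qed
  then obtain T d where T: "finite T" "T \<subseteq> M"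
    and d: "\<And>u. coef p u - (\<Sum>m\<in>T. d m * coef (G m) u) \<in> \<aa>"
    by blast
  \<comment> \<open>Only the summands that are nonzero over the quotient ring matter.\<close>
  define T' where "T' = {m \<in> T. d m \<notin> \<aa>}"
  have T': "finite T'" "T' \<subseteq> M" using T by (auto simp: T'_def)
  have d': "coef p u - (\<Sum>m\<in>T'. d m * coef (G m) u) \<in> \<aa>" for u
  proof -
    have "(\<Sum>m\<in>T - T'. coef (G m) u * d m) \<in> \<aa>"
      by (intro ideal_sum[OF \<aa>] ideal_mult[OF \<aa>]) (auto simp: T'_def)
    from ideal_add[OF \<aa> d[of u] this] show ?thesis
      using sum.subset_diff[of T' T "\<lambda>m. d m * coef (G m) u"] T
      by (auto simp: T'_def algebra_simps)
  qed
  have "T' \<noteq> {}" using d'[of v] not by auto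
  with T'(1) have "\<exists>m\<in>T'. \<forall>k\<in>T'. k \<noteq> m \<longrightarrow> lt k m"
  proof (induction rule: finite_ne_induct)
    case (insert x F)
    then show ?case by (metis insert_iff lt_total lt_trans)
  qed simp
  then obtain m where m: "m \<in> T'" "\<And>k. k \<in> T' \<Longrightarrow> k \<noteq> m \<Longrightarrow> lt k m" by blast
  have vanish: "coef (G k) u = 0" if "k \<in> T'" "u = m \<and> k \<noteq> m \<or> lt m u" for k u
  proof (rule ccontr)
    assume "coef (G k) u \<noteq> 0"
    then have "u = k \<or> lt u k" using lower[of k u] that T' by (auto simp: in_keys_iff)
    then show False using that m(2) lt_irrefl lt_trans by metis
  qed
  have "coef p m \<notin> \<aa>"
  proof
    assume *: "coef p m \<in> \<aa>"
    have "(\<Sum>k\<in>T'. d k * coef (G k) m) = (\<Sum>k\<in>T'. if k = m then d k else 0)"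
      using T' m by (intro sum.cong) (auto simp: vanish lead)
    then have "coef p m - d m \<in> \<aa>" using d'[of m] T' m by simp
    from ideal_diff[OF \<aa> * this] m(1) show False by (simp add: T'_def)
  qed
  moreover have "coef p u \<in> \<aa>" if "lt m u" for u
    using d'[of u] that by (simp add: vanish)
  ultimately show ?thesis using m T' by blast
qed

lemma standard_independent:
  assumes \<aa>: "is_ideal \<aa>" and S: "finite S" "S \<inter> M = {}"
    and mem: "(\<Sum>s\<in>S. term_xy s (c s)) \<in> ideal_gen (G ` M \<union> const_xy ` \<aa>)"
    and s: "s \<in> S"
  shows "c s \<in> \<aa>"
proof (rule ccontr)
  assume "c s \<notin> \<aa>"
  then have "coef (\<Sum>s\<in>S. term_xy s (c s)) s \<notin> \<aa>" using s S by (simp add: coef_sum_terms)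
  from leading_monomial_in_M[OF \<aa> mem this] S show False
    by (auto simp: coef_sum_terms ideal_zero[OF \<aa>] split: if_splits)
qed

definition basis_at :: "mon \<Rightarrow> 'r xy" where
  "basis_at u = (if u \<in> M then G u else term_xy u 1)"

text \<open>
  Exchanging \<open>m\<close> for \<open>G m\<close> at each monomial of \<open>M\<close> is a unitriangular change of basis in every degree.
  Its inverse needs no division, so it stays within any subring \<open>S\<close> containing the coefficients of the
  \<open>G m\<close>. The subring makes it possible to keep track of the variables that occur.
\<close>
lemma basis_expansion:
  assumes S: "is_subring S" and G: "\<And>m u. m \<in> M \<Longrightarrow> coef (G m) u \<in> S"
    and p: "homogeneous_of \<alpha> \<beta> a p" "\<And>u. coef p u \<in> S"
  shows "\<exists>e. (\<forall>u. e u \<in> S) \<and> p = (\<Sum>u | deg \<alpha> \<beta> u = a. scal (e u) (basis_at u))"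
proof -
  let ?D = "{u. deg \<alpha> \<beta> u = a}"
  define Rep where "Rep = {\<Sum>u\<in>?D. scal (e u) (basis_at u) | e. \<forall>u. e u \<in> S}"
  note S' = is_subringD[OF S]
  have fin: "finite ?D" using pos by (rule finite_degree)
  have add: "x + y \<in> Rep" if xy: "x \<in> Rep" "y \<in> Rep" for x y
  proof -
    from xy obtain e e' where "\<forall>u. e u \<in> S" "\<forall>u. e' u \<in> S"
      "x = (\<Sum>u\<in>?D. scal (e u) (basis_at u))" "y = (\<Sum>u\<in>?D. scal (e' u) (basis_at u))"
      by (auto simp: Rep_def)
    then show ?thesis unfolding Rep_def
      by (intro CollectI exI[of _ "\<lambda>u. e u + e' u"])
        (auto simp: single_add distrib_right sum.distrib S')
  qed
  have scale: "scal c x \<in> Rep" if x: "x \<in> Rep" "c \<in> S" for x c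
  proof -
    from x obtain e where "\<forall>u. e u \<in> S" "x = (\<Sum>u\<in>?D. scal (e u) (basis_at u))"
      by (auto simp: Rep_def)
    with x show ?thesis unfolding Rep_def
      by (intro CollectI exI[of _ "\<lambda>u. c * e u"])
        (auto simp: sum_distrib_left mult_single S' simp flip: mult.assoc)
  qed
  have zero: "0 \<in> Rep" unfolding Rep_def
    by (intro CollectI exI[of _ "\<lambda>u. 0"]) (auto simp: S')
  have sum: "(\<Sum>x\<in>X. f x) \<in> Rep" if "finite X" "\<And>x. x \<in> X \<Longrightarrow> f x \<in> Rep"
    for X :: "mon set" and f
    using that by induction (auto intro: add zero)
  have basis: "basis_at v \<in> Rep" if "v \<in> ?D" for v
  proof -
    have "(\<Sum>u\<in>?D. scal (if u = v then 1 else 0) (basis_at u))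
        = (\<Sum>u\<in>?D. if u = v then basis_at u else 0)"
      by (intro sum.cong) auto
    also have "\<dots> = basis_at v" using that fin by simp
    finally show ?thesis unfolding Rep_def
      by (intro CollectI exI[of _ "\<lambda>u. if u = v then 1 else 0"]) (auto simp: S')
  qed
  have monomial: "term_xy v 1 \<in> Rep" if "v \<in> ?D" for v
    using that
  proof (induction v rule: wf_induct_rule[OF lt_wf])
    case (1 v)
    show ?case
    proof (cases "v \<in> M")
      case False
      then show ?thesis using basis[of v] 1 by (simp add: basis_at_def)
    next
      case True
      have "G v = (\<Sum>u\<in>insert v (supp (G v)). term_xy u (coef (G v) u))"
        by (rule sum_of_terms) auto
      also have "\<dots> = term_xy v 1 + (\<Sum>u\<in>supp (G v) - {v}. term_xy u (coef (G v) u))"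
        by (simp add: sum.insert_remove lead True)
      finally have "term_xy v 1 = G v - (\<Sum>u\<in>supp (G v) - {v}. term_xy u (coef (G v) u))"
        by (rule add_implies_diff[OF sym])
      then have "term_xy v 1
          = basis_at v + (\<Sum>u\<in>supp (G v) - {v}. scal (- coef (G v) u) (term_xy u 1))"
        using True by (simp add: basis_at_def mult_single single_uminus sum_negf)
      moreover have "scal (- coef (G v) u) (term_xy u 1) \<in> Rep" if "u \<in> supp (G v) - {v}" for u
        using that True 1 lower[of v u] same_degree[of v u]
        by (intro scale) (auto simp: S' G)
      ultimately show ?thesis
        using sum[of "supp (G v) - {v}" "\<lambda>u. scal (- coef (G v) u) (term_xy u 1)"]
          add[OF basis[OF 1(2)]]
        by simp
    qed
  qed
  have "p = (\<Sum>u\<in>?D. scal (coef p u) (term_xy u 1))"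
    using sum_of_terms[OF fin, of p] p(1) by (auto simp: homogeneous_of_def mult_single)
  also have "\<dots> \<in> Rep" by (intro sum fin scale monomial p)
  finally show ?thesis by (auto simp: Rep_def)
qed

lemma standard_spanning:
  assumes S: "is_subring S" and G: "\<And>m u. m \<in> M \<Longrightarrow> coef (G m) u \<in> S"
    and p: "homogeneous_of \<alpha> \<beta> a p" "\<And>u. coef p u \<in> S"
  shows "\<exists>e. (\<forall>u. e u \<in> S) \<and> p = (\<Sum>s | s \<notin> M \<and> deg \<alpha> \<beta> s = a. term_xy s (e s))
      + (\<Sum>m | m \<in> M \<and> deg \<alpha> \<beta> m = a. scal (e m) (G m))"
proof -
  obtain e where e: "\<forall>u. e u \<in> S"
    and p_eq: "p = (\<Sum>u | deg \<alpha> \<beta> u = a. scal (e u) (basis_at u))"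
    using basis_expansion[OF assms] by blast
  have fin: "finite {u. deg \<alpha> \<beta> u = a}" using pos by (rule finite_degree)
  let ?A = "{s. s \<notin> M \<and> deg \<alpha> \<beta> s = a}" and ?B = "{m. m \<in> M \<and> deg \<alpha> \<beta> m = a}"
  have "{u. deg \<alpha> \<beta> u = a} = ?A \<union> ?B" by auto
  then have "p = (\<Sum>u\<in>?A \<union> ?B. scal (e u) (basis_at u))" by (simp only: p_eq)
  also have "\<dots> = (\<Sum>s\<in>?A. scal (e s) (basis_at s)) + (\<Sum>m\<in>?B. scal (e m) (basis_at m))"
    by (intro sum.union_disjoint) (auto intro: finite_subset[OF _ fin])
  finally have split: "p = (\<Sum>s\<in>?A. scal (e s) (basis_at s)) + (\<Sum>m\<in>?B. scal (e m) (basis_at m))" .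
  have standard: "(\<Sum>s | s \<notin> M \<and> deg \<alpha> \<beta> s = a. scal (e s) (basis_at s))
      = (\<Sum>s | s \<notin> M \<and> deg \<alpha> \<beta> s = a. term_xy s (e s))"
    by (rule sum.cong[OF refl]) (simp add: basis_at_def mult_single)
  have reducible: "(\<Sum>m | m \<in> M \<and> deg \<alpha> \<beta> m = a. scal (e m) (basis_at m))
      = (\<Sum>m | m \<in> M \<and> deg \<alpha> \<beta> m = a. scal (e m) (G m))"
    by (rule sum.cong[OF refl]) (simp add: basis_at_def)
  show ?thesis by (rule exI[of _ e], rule conjI[OF e split[unfolded standard reducible]])
qed

lemma standard_mod_ideal:
  assumes p: "homogeneous_of \<alpha> \<beta> a p"
  shows "\<exists>e. p - (\<Sum>s | s \<notin> M \<and> deg \<alpha> \<beta> s = a. term_xy s (e s)) \<in> ideal_gen (G ` M \<union> const_xy ` \<aa>)"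
proof -
  have "is_subring (UNIV :: 'r set)" by (auto simp: is_subring_def)
  from standard_spanning[OF this _ p] obtain e
    where "p = (\<Sum>s | s \<notin> M \<and> deg \<alpha> \<beta> s = a. term_xy s (e s))
      + (\<Sum>m | m \<in> M \<and> deg \<alpha> \<beta> m = a. scal (e m) (G m))"
    by auto
  then have "p - (\<Sum>s | s \<notin> M \<and> deg \<alpha> \<beta> s = a. term_xy s (e s))
      = (\<Sum>m | m \<in> M \<and> deg \<alpha> \<beta> m = a. scal (e m) (G m))"
    by simp
  also have "\<dots> \<in> ideal_gen (G ` M \<union> const_xy ` \<aa>)"
    by (intro ideal_sum[OF ideal_gen_is_ideal] ideal_mult[OF ideal_gen_is_ideal] ideal_gen_base) auto
  finally show ?thesis by blast
qed

lemma homogeneous_ideal_gen: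
  assumes \<aa>: "is_ideal \<aa>"
  shows "homogeneous_ideal \<alpha> \<beta> (ideal_gen (G ` M \<union> const_xy ` \<aa>))" (is "homogeneous_ideal _ _ ?I")
  unfolding homogeneous_ideal_def
proof (intro conjI ballI allI ideal_gen_is_ideal)
  fix p a assume "p \<in> ?I"
  then show "hom_part \<alpha> \<beta> a p \<in> ?I"
    unfolding ideal_eq_coeff_span[OF \<aa>]
  proof (induction rule: coeff_span_induct)
    case zero
    have "hom_part \<alpha> \<beta> a 0 = (0 :: 'r xy)"
      by (rule poly_mapping_eqI) (simp add: coef_hom_part)
    then show ?case by (simp add: coeff_span_zero)
  next
    case (step c x y)
    have expand: "hom_part \<alpha> \<beta> a (scal c x + y) = scal c (hom_part \<alpha> \<beta> a x) + hom_part \<alpha> \<beta> a y"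
      by (rule poly_mapping_eqI) (simp add: coef_hom_part lookup_add coef_const_mult)
    obtain b where b: "\<And>u. coef x u \<noteq> 0 \<Longrightarrow> deg \<alpha> \<beta> u = b"
    proof -
      from step(1) consider m where "m \<in> M" "x = G m" | u c where "x = term_xy u c" by auto
      then have "\<exists>b. \<forall>u\<in>supp x. deg \<alpha> \<beta> u = b" 
      proof cases
        case 1
        then show ?thesis using same_degree by blast
      next
        case (2 u c)
        then show ?thesis by (intro exI[of _ "deg \<alpha> \<beta> u"]) simp
      qed
      then show ?thesis using that by (auto simp: in_keys_iff)
    qed
    then have part: "hom_part \<alpha> \<beta> a x = (if a = b then x else 0)"
      by (intro poly_mapping_eqI) (auto simp: coef_hom_part)
    show ?case
      unfolding expand part using step
      by (intro coeff_span_add coeff_span_scale) (simp_all add: coeff_span_base coeff_span_zero)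
  qed
qed

text \<open>
  A leading coefficient at a monomial outside \<open>M\<close> lies in \<open>\<aa>\<close>, since the largest monomial with
  coefficient outside \<open>\<aa>\<close> belongs to \<open>M\<close>; in the other direction \<open>G m\<close> has leading term \<open>m\<close>.
\<close>
lemma initial_ideal_eq:
  assumes \<aa>: "is_ideal \<aa>"
  shows "initial_ideal lt (ideal_gen (G ` M \<union> const_xy ` \<aa>))
    = ideal_gen ((\<lambda>m. term_xy m 1) ` M \<union> const_xy ` \<aa>)" (is "initial_ideal lt ?I = ?R")
proof
  have gen: "term_xy m c \<in> ?R" if "m \<in> M \<or> c \<in> \<aa>" for m c
  proof -
    have "term_xy m c = term_xy 0 c * term_xy m 1" "term_xy m c = term_xy m 1 * term_xy 0 c"
      by (simp_all add: mult_single)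
    with that show ?thesis
      by (metis (no_types, lifting) UnCI ideal_gen_base ideal_gen_is_ideal ideal_mult imageI)
  qed
  show "initial_ideal lt ?I \<subseteq> ?R"
    unfolding initial_ideal_def
  proof (intro ideal_gen_minimal ideal_gen_is_ideal subsetI)
    fix x assume "x \<in> {term_xy m c | m c. \<exists>q. (\<forall>u\<in>supp q. lt u m) \<and> term_xy m c + q \<in> ?I}"
    then obtain m c q where x: "x = term_xy m c" and q: "\<And>u. u \<in> supp q \<Longrightarrow> lt u m"
      and mem: "term_xy m c + q \<in> ?I" by blast
    have "m \<notin> supp q" using q lt_irrefl by blast
    then have coef_m: "coef (term_xy m c + q) m = c"
      by (simp add: lookup_add in_keys_iff)
    have "m \<in> M" if "c \<notin> \<aa>"
    proof -
      from leading_monomial_in_M[OF \<aa> mem, of m] that coef_m obtain m'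
        where m': "m' \<in> M" "coef (term_xy m c + q) m' \<notin> \<aa>"
          "\<forall>u. lt m' u \<longrightarrow> coef (term_xy m c + q) u \<in> \<aa>"
        by auto
      have "m' = m"
      proof (rule ccontr)
        assume ne: "m' \<noteq> m"
        then have "coef q m' \<noteq> 0" using m'(2) ideal_zero[OF \<aa>]
          by (auto simp: lookup_add lookup_single when_def)
        then have "lt m' m" using q by (simp add: in_keys_iff)
        with m'(3) coef_m that show False by metis
      qed
      with m' show ?thesis by simp
    qed
    then show "x \<in> ?R" unfolding x using gen by blast
  qed
  show "?R \<subseteq> initial_ideal lt ?I"
    unfolding initial_ideal_def
  proof (intro ideal_gen_minimal ideal_gen_is_ideal subsetI ideal_gen_base)
    fix x assume "x \<in> (\<lambda>m. term_xy m 1) ` M \<union> const_xy ` \<aa>"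
    then consider m where "m \<in> M" "x = term_xy m 1" | c where "c \<in> \<aa>" "x = const_xy c" by auto
    then show "x \<in> {term_xy m c | m c. \<exists>q. (\<forall>u\<in>supp q. lt u m) \<and> term_xy m c + q \<in> ?I}"
    proof cases
      case 1
      have "u \<in> supp (G m - term_xy m 1) \<Longrightarrow> lt u m" for u
        using lower[of m u] lead[of m] 1
        by (cases "u = m") (auto simp: in_keys_iff lookup_minus lookup_single_not_eq)
      moreover have "term_xy m 1 + (G m - term_xy m 1) \<in> ?I" using 1 by (auto intro: ideal_gen_base)
      ultimately show ?thesis using 1 by blast
    next
      case 2
      then show ?thesis
        by (intro CollectI exI[of _ 0] exI[of _ c] conjI) (auto intro: ideal_gen_base)
    qed
  qed
qed

text \<open>
  The quotient is free on the standard monomials, so a single basis works at every prime and the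
  localising element can be taken to be 1.
\<close>
theorem in_cell:
  assumes \<aa>: "is_ideal \<aa>" and H: "\<And>a. H a = card {s. s \<notin> M \<and> deg \<alpha> \<beta> s = a}"
  shows "ideal_gen (G ` M \<union> const_xy ` \<aa>) \<in> cell_points lt \<alpha> \<beta> H M \<aa>" (is "?I \<in> _")
proof -
  have "locally_free_rank \<alpha> \<beta> \<aa> ?I a (H a)" for a
  proof -
    let ?S = "{s. s \<notin> M \<and> deg \<alpha> \<beta> s = a}"
    have fin: "finite ?S" by (rule finite_subset[OF _ finite_degree[OF pos, of a]]) auto
    obtain f where f: "bij_betw f {..<H a} ?S"
      using ex_bij_betw_nat_finite[OF fin] H by (auto simp: atLeast0LessThan)
    define vs where "vs = map (\<lambda>i. term_xy (f i) (1::'r)) [0..<H a]"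
    have sum: "(\<Sum>i<H a. const_xy (c i) * vs ! i) = (\<Sum>i<H a. term_xy (f i) (c i))" for c
      by (intro sum.cong) (auto simp: vs_def mult_single)
    have len: "length vs = H a" by (simp add: vs_def)
    have hom: "\<forall>v\<in>set vs. homogeneous_of \<alpha> \<beta> a v"
      using f by (auto simp: vs_def homogeneous_of_def bij_betw_def)
    have span: "\<exists>k c. const_xy (1 ^ k) * p - (\<Sum>i<H a. const_xy (c i) * vs ! i) \<in> ?I"
      if p: "homogeneous_of \<alpha> \<beta> a p" for p
    proof -
      obtain e where "p - (\<Sum>s\<in>?S. term_xy s (e s)) \<in> ?I"
        using standard_mod_ideal[OF p] by blast
      then have "p - (\<Sum>i<H a. const_xy (e (f i)) * vs ! i) \<in> ?I"
        unfolding sum sum.reindex_bij_betw[OF f, of "\<lambda>s. term_xy s (e s)"] .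
      then show ?thesis by (intro exI[of _ 0] exI[of _ "\<lambda>i. e (f i)"]) simp
    qed
    have indep: "\<exists>k. 1 ^ k * c i \<in> \<aa>" if "(\<Sum>i<H a. const_xy (c i) * vs ! i) \<in> ?I" "i < H a" for c i
    proof -
      define c' where "c' = c \<circ> the_inv_into {..<H a} f"
      have c': "c' (f i) = c i" if "i < H a" for i
        using f that by (simp add: c'_def bij_betw_def the_inv_into_f_f)
      have "(\<Sum>s\<in>?S. term_xy s (c' s)) = (\<Sum>i<H a. const_xy (c i) * vs ! i)"
        unfolding sum sum.reindex_bij_betw[OF f, of "\<lambda>s. term_xy s (c' s)", symmetric]
        by (intro sum.cong) (auto simp: c')
      with that(1) have "(\<Sum>s\<in>?S. term_xy s (c' s)) \<in> ?I" by simp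
      moreover have "f i \<in> ?S" using f that(2) by (auto simp: bij_betw_def)
      ultimately have "c' (f i) \<in> \<aa>" by (intro standard_independent[OF \<aa> fin]) auto
      with c' that(2) show ?thesis by simp
    qed
    show ?thesis
      unfolding locally_free_rank_def
    proof (intro allI impI)
      fix P assume P: "is_prime_ideal P \<and> \<aa> \<subseteq> P"
      then have "1 \<notin> P" by (simp add: is_prime_ideal_def)
      then show "\<exists>s vs. s \<notin> P \<and> length vs = H a \<and> (\<forall>v\<in>set vs. homogeneous_of \<alpha> \<beta> a v) \<and>
          (\<forall>p. homogeneous_of \<alpha> \<beta> a p \<longrightarrow>
             (\<exists>k c. const_xy (s ^ k) * p - (\<Sum>i<H a. const_xy (c i) * vs ! i) \<in> ?I)) \<and>
          (\<forall>c. (\<Sum>i<H a. const_xy (c i) * vs ! i) \<in> ?I \<longrightarrow> (\<forall>i<H a. \<exists>k. s ^ k * c i \<in> \<aa>))"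
        using len hom span indep by (intro exI[of _ 1] exI[of _ vs]) blast
    qed
  qed
  moreover have "const_xy ` \<aa> \<subseteq> ?I" by (auto intro: ideal_gen_base)
  ultimately show ?thesis
    unfolding cell_points_def hilbert_points_def
    using homogeneous_ideal_gen[OF \<aa>] initial_ideal_eq[OF \<aa>] by blast
qed

end


definition laurent_deg :: "nat \<Rightarrow> nat \<Rightarrow> int \<times> int \<Rightarrow> int" where
  "laurent_deg \<alpha> \<beta> u = int \<alpha> * fst u + int \<beta> * snd u"

section \<open>The bases of the families of Evain\<close>

text \<open>
  Both families are treated at once by naming the coordinates according to their role: the order
  compares exponents \<open>q\<close> first and \<open>p\<close> second, and multiplication by \<open>r\<close> raises \<open>p\<close> and lowers \<open>q\<close>.
  \<open>P\<close> and \<open>Q\<close> are the same coordinates of Laurent monomials.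
\<close>
locale staircase =
  fixes lt :: "mon \<Rightarrow> mon \<Rightarrow> bool" and r :: "int \<times> int"
    and p q :: "mon \<Rightarrow> nat" and P Q :: "int \<times> int \<Rightarrow> int"
    and \<alpha> \<beta> :: nat and M :: "mon set"
  assumes orientation:
      "lt = lex \<and> r = r_vec \<alpha> \<beta> \<and> p = fst \<and> q = snd \<and> P = fst \<and> Q = snd \<or>
       lt = lex_opp \<and> r = r_inv_vec \<alpha> \<beta> \<and> p = snd \<and> q = fst \<and> P = snd \<and> Q = fst"
    and pos: "0 < \<alpha>" "0 < \<beta>"
    and up_closed: "m \<in> M \<Longrightarrow> m \<le> m' \<Longrightarrow> m' \<in> M"
begin

lemma lt_iff: "lt u v \<longleftrightarrow> q u < q v \<or> q u = q v \<and> p u < p v"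
  using orientation by (auto simp: lex_def lex_opp_def)

lemma le_iff: "u \<le> v \<longleftrightarrow> p u \<le> p v \<and> q u \<le> q v"
  using orientation by (auto simp: less_eq_prod_def)

lemma eq_iff: "u = v \<longleftrightarrow> p u = p v \<and> q u = q v"
  using orientation by (auto simp: prod_eq_iff)

lemma coordinates:
  "p (u + v) = p u + p v" "q (u + v) = q u + q v"
  "p (u - v) = p u - p v" "q (u - v) = q u - q v"
  "p (sup u v) = max (p u) (p v)" "q (sup u v) = max (q u) (q v)"
  "P (x + y) = P x + P y" "Q (x + y) = Q x + Q y"
  "P (x - y) = P x - P y" "Q (x - y) = Q x - Q y"
  "P (lmon u) = int (p u)" "Q (lmon u) = int (q u)"
  "P (rpow r l) = int l * P r" "Q (rpow r l) = int l * Q r"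
  using orientation by (auto simp: lmon_def rpow_def sup_max)

lemma r_sign: "0 < P r" "Q r < 0"
  using orientation pos by (auto simp: r_vec_def r_inv_vec_def)

lemma laurent_deg_simps:
  "laurent_deg \<alpha> \<beta> (x + y) = laurent_deg \<alpha> \<beta> x + laurent_deg \<alpha> \<beta> y"
  "laurent_deg \<alpha> \<beta> (x - y) = laurent_deg \<alpha> \<beta> x - laurent_deg \<alpha> \<beta> y"
  "laurent_deg \<alpha> \<beta> (lmon u) = int (deg \<alpha> \<beta> u)"
  "laurent_deg \<alpha> \<beta> (rpow r l) = 0"
  using orientation
  by (auto simp: laurent_deg_def deg_def lmon_def rpow_def r_vec_def r_inv_vec_def algebra_simps)

lemma lmon_eq_iff: "lmon u = lmon v \<longleftrightarrow> u = v"
  by (auto simp: lmon_def prod_eq_iff)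

lemma lmon_le_iff: "lmon u \<le> lmon v \<longleftrightarrow> u \<le> v"
  by (auto simp: lmon_def less_eq_prod_def)

lemma lmon_add: "lmon (u + v) = lmon u + lmon v"
  by (simp add: lmon_def prod_eq_iff)

lemma lmon_diff: "v \<le> u \<Longrightarrow> lmon (u - v) = lmon u - lmon v"
  by (auto simp: lmon_def prod_eq_iff less_eq_prod_def)

lemma nonneg_lmon:
  assumes "0 \<le> P x" "0 \<le> Q x"
  obtains u where "x = lmon u"
proof -
  have "x = lmon (nat (fst x), nat (snd x))"
    using orientation assms by (auto simp: lmon_def)
  then show ?thesis by (rule that)
qed

lemma mingens_incomparable:
  assumes "u \<in> mingens M" "v \<in> mingens M" "u \<noteq> v"
  shows "q u < q v \<and> p v < p u \<or> q v < q u \<and> p u < p v"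
proof -
  have "\<not> u \<le> v" "\<not> v \<le> u" using assms by (auto simp: mingens_def)
  then show ?thesis by (auto simp: le_iff)
qed

lemma inj_on_mingens: "inj_on q (mingens M)" "inj_on p (mingens M)"
  using mingens_incomparable by (fastforce simp: inj_on_def)+

text \<open>
  Any minimal generator has a smaller or equal exponent than a fixed one in at least one of the
  coordinates, and no value of an exponent occurs twice.
\<close>
lemma finite_mingens: "finite (mingens M)"
proof (cases "mingens M = {}")
  case False
  then obtain g where g: "g \<in> mingens M" by blast
  have "mingens M \<subseteq> (q -` {..q g} \<inter> mingens M) \<union> (p -` {..p g} \<inter> mingens M)"
    using mingens_incomparable[OF _ g] by force
  moreover have "finite (q -` {..q g} \<inter> mingens M)" "finite (p -` {..p g} \<inter> mingens M)"
    using inj_on_mingens by (auto intro: finite_vimage_IntI)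
  ultimately show ?thesis by (meson finite_UnI finite_subset)
qed simp

lemma mingen_below:
  assumes "m \<in> M"
  shows "\<exists>g\<in>mingens M. g \<le> m"
  using assms
proof (induction "p m + q m" arbitrary: m rule: less_induct)
  case less
  show ?case
  proof (cases "m \<in> mingens M")
    case False
    then obtain u where u: "u \<in> M" "u \<le> m" "u \<noteq> m" using less.prems by (auto simp: mingens_def)
    then have "p u + q u < p m + q m" by (auto simp: le_iff eq_iff)
    from less.hyps[OF this u(1)] u(2) show ?thesis by (meson order_trans)
  qed auto
qed

abbreviation ms :: "mon list" where "ms \<equiv> gens lt M"

text \<open>
  On minimal generators the order amounts to comparing the exponents \<open>q\<close>, which are distinct. Hence the
  increasing enumeration exists and is unique, and \<open>gens\<close> is meaningful.
\<close>
lemma gens_props: "set ms = mingens M \<and> sorted_wrt lt ms \<and> distinct ms"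
proof -
  let ?ok = "\<lambda>ms. set ms = mingens M \<and> sorted_wrt lt ms \<and> distinct ms"
  have sorted: "sorted_wrt (<) (map q xs)" if "?ok xs" for xs
  proof -
    have "sorted_wrt (\<lambda>u v. q u < q v) xs"
    proof (rule sorted_wrt_mono_rel[of _ lt])
      fix u v assume "u \<in> set xs" "v \<in> set xs" "lt u v"
      then show "q u < q v" using that mingens_incomparable[of u v]
        by (cases "u = v") (auto simp: lt_iff)
    qed (use that in blast)
    then show ?thesis by (simp add: sorted_wrt_map)
  qed
  have unique: "xs = ys" if "?ok xs" "?ok ys" for xs ys
  proof -
    have "map q xs = map q ys"
      by (rule strict_sorted_equal[OF sorted[OF that(2)] sorted[OF that(1)]]) (use that in auto)
    then show ?thesis using that inj_on_mingens(1) by (auto intro: inj_on_map_eq_map[THEN iffD1])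
  qed
  define xs where "xs = map (inv_into (mingens M) q) (sorted_list_of_set (q ` mingens M))"
  have qs: "map q xs = sorted_list_of_set (q ` mingens M)"
    using finite_mingens by (auto simp: xs_def f_inv_into_f intro!: map_idI)
  have set: "set xs = mingens M"
    using finite_mingens inj_on_mingens(1) by (simp add: xs_def inv_into_image_cancel)
  have strict: "sorted_wrt (<) (map q xs)" unfolding qs by simp
  then have "sorted_wrt lt xs"
    unfolding sorted_wrt_map by (rule sorted_wrt_mono_rel[rotated]) (simp add: lt_iff)
  moreover have "distinct xs" using strict
    by (metis distinct_map strict_sorted_iff)
  ultimately have "?ok xs" using set by blast
  then have "\<exists>!xs. ?ok xs" using unique by blast
  from theI'[OF this] show ?thesis unfolding gens_def .
qed

lemma gen_in_M: "i < length ms \<Longrightarrow> ms ! i \<in> M"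
  using gens_props by (metis (no_types, lifting) mem_Collect_eq mingens_def nth_mem)

lemma gens_mono:
  assumes "i < j" "j < length ms"
  shows "q (ms ! i) < q (ms ! j)" "p (ms ! j) < p (ms ! i)"
proof -
  have "lt (ms ! i) (ms ! j)" using gens_props assms by (simp add: sorted_wrt_iff_nth_less)
  moreover have "ms ! i \<in> mingens M" "ms ! j \<in> mingens M" using gens_props assms
    by (metis nth_mem order.strict_trans)+
  moreover have "ms ! i \<noteq> ms ! j" using gens_props assms by (simp add: nth_eq_iff_index_eq)
  ultimately have "q (ms ! i) < q (ms ! j) \<and> p (ms ! j) < p (ms ! i)"
    using mingens_incomparable[of "ms ! i" "ms ! j"] unfolding lt_iff by linarith
  then show "q (ms ! i) < q (ms ! j)" "p (ms ! j) < p (ms ! i)" by simp_all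
qed

abbreviation last_index :: "mon \<Rightarrow> nat" where "last_index m \<equiv> last_div lt M (lmon m)"

text \<open>
  For a monomial of the ideal, the last generator dividing it is determined by \<open>q\<close> alone: later
  generators have smaller \<open>p\<close>, so they divide as soon as their \<open>q\<close> is small enough.
\<close>
lemma last_index_props:
  assumes "m \<in> M"
  shows "last_index m < length ms" "ms ! last_index m \<le> m" "\<And>j. j < length ms \<Longrightarrow> q (ms ! j) \<le> q m \<Longrightarrow> j \<le> last_index m"
proof -
  let ?J = "{j. j < length ms \<and> lmon (ms ! j) \<le> lmon m}"
  have fin: "finite ?J" by simp
  obtain g where "g \<in> mingens M" "g \<le> m" using mingen_below[OF assms] by blast
  then obtain k where "k < length ms" "ms ! k \<le> m" using gens_props by (metis in_set_conv_nth)
  then have "?J \<noteq> {}" by (auto simp: lmon_le_iff)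
  from Max_in[OF fin this] have *: "last_index m \<in> ?J" by (simp add: last_div_def)
  then show le: "last_index m < length ms" "ms ! last_index m \<le> m" by (auto simp: lmon_le_iff)
  fix j assume j: "j < length ms" "q (ms ! j) \<le> q m"
  show "j \<le> last_index m"
  proof (rule ccontr)
    assume "\<not> j \<le> last_index m"
    then have "p (ms ! j) < p (ms ! last_index m)" using gens_mono j by simp
    then have "j \<in> ?J" using j le(2) by (simp add: lmon_le_iff le_iff)
    then have "j \<le> last_index m" using Max_ge[OF fin] by (simp add: last_div_def)
    with \<open>\<not> j \<le> last_index m\<close> show False by simp
  qed
qed

lemma last_index_cong:
  assumes "m \<in> M" "m' \<in> M" "q m = q m'"
  shows "last_index m = last_index m'"
  using last_index_props[OF assms(1)] last_index_props[OF assms(2)] assms(3)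
  by (intro le_antisym) (simp_all add: le_iff)

lemma last_index_gen: "i < length ms \<Longrightarrow> last_index (ms ! i) = i"
proof (rule le_antisym)
  assume i: "i < length ms"
  note props = last_index_props[OF gen_in_M[OF i]]
  show "i \<le> last_index (ms ! i)" using props(3)[OF i] by simp
  show "last_index (ms ! i) \<le> i"
  proof (rule ccontr)
    assume "\<not> last_index (ms ! i) \<le> i"
    then have "q (ms ! i) < q (ms ! last_index (ms ! i))" using gens_mono(1) props(1) by simp
    with props(2) show False by (simp add: le_iff)
  qed
qed

text \<open>
  Multiplying \<open>lcm(m_i, m_{i+1})\<close> by a power of \<open>r\<close> takes \<open>q\<close> below that of the generator \<open>i + 1\<close>. This is why the
  recursion only refers to earlier generators.
\<close>
lemma arrowD:
  assumes i: "Suc i < length ms" and l: "(ms ! Suc i, l) \<in> arrows lt r M"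
  obtains w where "w \<in> M" "lmon (sup (ms ! i) (ms ! Suc i)) + rpow r l = lmon w"
    "int (p w) = int (p (ms ! i)) + int l * P r" "int (q w) = int (q (ms ! Suc i)) + int l * Q r"
    "0 < l" "last_index w < Suc i"
proof -
  obtain k where k: "1 \<le> k" "k < length ms" "ms ! Suc i = ms ! k" "0 < l"
    "lmon (sup (ms ! (k - 1)) (ms ! k)) + rpow r l \<in> lmon ` M"
    using l by (auto simp: arrows_def)
  then have "k = Suc i" using i gens_props by (simp add: nth_eq_iff_index_eq)
  then have "lmon (sup (ms ! i) (ms ! Suc i)) + rpow r l \<in> lmon ` M" using k(5) by simp
  then obtain w where w: "w \<in> M" "lmon (sup (ms ! i) (ms ! Suc i)) + rpow r l = lmon w"
    by (rule imageE)
  have mono: "q (ms ! i) < q (ms ! Suc i)" "p (ms ! Suc i) < p (ms ! i)" using gens_mono i by auto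
  have pw: "int (p w) = int (p (ms ! i)) + int l * P r"
    using arg_cong[OF w(2), of P] mono by (simp add: coordinates)
  have qw: "int (q w) = int (q (ms ! Suc i)) + int l * Q r"
    using arg_cong[OF w(2), of Q] mono by (simp add: coordinates)
  have "int l * Q r < 0" using k r_sign by (simp add: mult_pos_neg)
  then have "q w < q (ms ! Suc i)" using qw by linarith
  moreover have "q (ms ! last_index w) \<le> q w" using last_index_props(2)[OF w(1)] by (simp add: le_iff)
  ultimately have "q (ms ! last_index w) < q (ms ! Suc i)" by simp
  then have "last_index w < Suc i"
    using gens_mono(1)[of "Suc i" "last_index w"] last_index_props(1)[OF w(1)] by (metis linorder_neqE_nat order.asym)
  with w pw qw k show ?thesis by (intro that)
qed

text \<open>
  The exponents that may occur in the \<open>i\<close>-th polynomial besides its leading one. The bound on \<open>P\<close> says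
  that the polynomial is divisible by the power of the \<open>p\<close>-variable in its leading monomial; this
  compensates the denominators in the recursion.
\<close>
abbreviation low :: "nat \<Rightarrow> (int \<times> int) set" where
  "low i \<equiv> {u. int (p (ms ! i)) \<le> P u \<and> 0 \<le> Q u \<and> Q u < int (q (ms ! i)) \<and>
     laurent_deg \<alpha> \<beta> u = int (deg \<alpha> \<beta> (ms ! i))}"

text \<open>
  By induction along the recursion. In a summand with \<open>f_j\<close> the exponent \<open>q\<close> stays nonnegative because
  \<open>m_j\<close> divides \<open>lcm(m_{i-1}, m_i) r^l\<close>, and it lies below that of \<open>m_i\<close> because \<open>r\<close> lowers \<open>q\<close>. The
  exponent \<open>p\<close> is bounded below because \<open>f_j\<close> is divisible by the \<open>p\<close>-part of \<open>m_j\<close> and \<open>r\<close> raises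
  \<open>p\<close>. Degrees agree since \<open>r\<close> has degree 0.
\<close>
lemma evain_f_lower_terms:
  assumes "i < length ms" "coef (evain_f lt r M c i - term_xy (lmon (ms ! i)) 1) u \<noteq> 0"
  shows "u \<in> low i"
  using assms
proof (induction i arbitrary: u rule: less_induct)
  case (less i)
  show ?case
  proof (cases i)
    case 0
    with less.prems show ?thesis by simp
  next
    case (Suc i')
    let ?f = "evain_f lt r M c" and ?m = "ms ! i'" and ?m' = "ms ! Suc i'"
    let ?L = "{l. (?m', l) \<in> arrows lt r M}"
    let ?j = "\<lambda>l. last_div lt M (lmon (sup ?m ?m') + rpow r l)"
    let ?T = "\<lambda>l. term_xy (lmon ?m' + rpow r l - lmon (ms ! ?j l)) (c (?m', l)) *
      (if ?j l < Suc i' then ?f (?j l) else 0)"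
    have len: "Suc i' < length ms" using less.prems Suc by simp
    have "?f (Suc i') - term_xy (lmon ?m') 1
        = term_xy (lmon ?m' - lmon ?m) 1 * (?f i' - term_xy (lmon ?m) 1) + (\<Sum>l\<in>?L. ?T l)"
      by (simp add: Let_def right_diff_distrib mult_single)
    then have "coef (term_xy (lmon ?m' - lmon ?m) 1 * (?f i' - term_xy (lmon ?m) 1)) u
        + (\<Sum>l\<in>?L. coef (?T l) u) \<noteq> 0"
      using less.prems Suc by (simp only: lookup_add lookup_sum not_False_eq_True)
    then consider "coef (?f i' - term_xy (lmon ?m) 1) (u - (lmon ?m' - lmon ?m)) \<noteq> 0"
      | "(\<Sum>l\<in>?L. coef (?T l) u) \<noteq> 0"
      unfolding coef_term_mult by fastforce
    then show ?thesis
    proof cases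
      case 1
      from less.IH[OF _ _ 1] len Suc have "u - (lmon ?m' - lmon ?m) \<in> low i'" by simp
      then show ?thesis
        using gens_mono[of i' "Suc i'"] len
        by (simp add: Suc coordinates laurent_deg_simps)
    next
      case 2
      then obtain l where l: "(?m', l) \<in> arrows lt r M" and nz: "coef (?T l) u \<noteq> 0"
        by (metis (no_types, lifting) mem_Collect_eq sum.not_neutral_contains_not_neutral)
      obtain w where w: "w \<in> M" "lmon (sup ?m ?m') + rpow r l = lmon w"
        "int (p w) = int (p ?m) + int l * P r" "int (q w) = int (q ?m') + int l * Q r" "0 < l"
        "last_index w < Suc i'"
        by (rule arrowD[OF len l])
      define v where "v = u - (lmon ?m' + rpow r l - lmon (ms ! last_index w))"
      have "coef (?f (last_index w)) v \<noteq> 0"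
        using nz w by (auto simp: coef_term_mult v_def)
      then have "v = lmon (ms ! last_index w) \<or> v \<in> low (last_index w)"
        using less.IH[of "last_index w" v] w(6) len Suc
        by (auto simp: lookup_minus lookup_single when_def)
      then have v: "int (p (ms ! last_index w)) \<le> P v" "0 \<le> Q v" "Q v \<le> int (q (ms ! last_index w))"
        "laurent_deg \<alpha> \<beta> v = int (deg \<alpha> \<beta> (ms ! last_index w))"
        by (auto simp: coordinates laurent_deg_simps)
      have "int l * Q r < 0" "0 \<le> int l * P r" using w(5) r_sign by (simp_all add: mult_pos_neg)
      moreover have "q (ms ! last_index w) \<le> q w" using last_index_props(2)[OF w(1)] by (simp add: le_iff)
      moreover have "u = v + (lmon ?m' + rpow r l - lmon (ms ! last_index w))" by (simp add: v_def)
      ultimately show ?thesis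
        using v w(4) by (simp add: Suc coordinates laurent_deg_simps)
    qed
  qed
qed

lemma evain_f_support:
  assumes "i < length ms" "coef (evain_f lt r M c i) u \<noteq> 0"
  shows "u = lmon (ms ! i) \<or> u \<in> low i"
  using evain_f_lower_terms[OF assms(1), of c u] assms(2)
  by (auto simp: lookup_minus lookup_single when_def)

lemma evain_f_leading_coefficient:
  assumes "i < length ms"
  shows "coef (evain_f lt r M c i) (lmon (ms ! i)) = 1"
proof -
  have "lmon (ms ! i) \<notin> low i" by (simp add: coordinates)
  then show ?thesis using evain_f_lower_terms[OF assms, of c "lmon (ms ! i)"]
    by (auto simp: lookup_minus)
qed

text \<open>
  This is \<open>G_m = (m/m_j) f_j\<close> with \<open>m_j\<close> the last generator dividing \<open>m\<close>. The computations take place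
  among Laurent polynomials, where the quotients in the recursion make sense.
\<close>
definition laurent_basis :: "(mon \<times> nat \<Rightarrow> 'r::comm_ring_1) \<Rightarrow> mon \<Rightarrow> 'r laurent" where
  "laurent_basis c m = term_xy (lmon m - lmon (ms ! last_index m)) 1 * evain_f lt r M c (last_index m)"

definition basis :: "(mon \<times> nat \<Rightarrow> 'r::comm_ring_1) \<Rightarrow> mon \<Rightarrow> 'r xy" where
  "basis c m = laurent_to_xy (laurent_basis c m)"

lemma laurent_basis_support:
  assumes m: "m \<in> M" and nz: "coef (laurent_basis c m) u \<noteq> 0"
  shows "int (p m) \<le> P u" "0 \<le> Q u" "u = lmon m \<or> Q u < int (q m)"
    "laurent_deg \<alpha> \<beta> u = int (deg \<alpha> \<beta> m)"
proof -
  let ?v = "u - (lmon m - lmon (ms ! last_index m))"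
  have "coef (evain_f lt r M c (last_index m)) ?v \<noteq> 0"
    using nz by (simp add: laurent_basis_def coef_term_mult)
  from evain_f_support[OF last_index_props(1)[OF m] this]
  have "?v = lmon (ms ! last_index m) \<or> ?v \<in> low (last_index m)" .
  moreover have "?v = lmon (ms ! last_index m) \<longleftrightarrow> u = lmon m" by (simp add: algebra_simps)
  moreover have "ms ! last_index m \<le> m" by (rule last_index_props(2)[OF m])
  ultimately show "int (p m) \<le> P u" "0 \<le> Q u" "u = lmon m \<or> Q u < int (q m)"
    "laurent_deg \<alpha> \<beta> u = int (deg \<alpha> \<beta> m)"
    by (auto simp: coordinates laurent_deg_simps le_iff)
qed

lemma laurent_basis_leading_coefficient:
  "m \<in> M \<Longrightarrow> coef (laurent_basis c m) (lmon m) = 1"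
  using evain_f_leading_coefficient[OF last_index_props(1)]
  by (simp add: laurent_basis_def coef_term_mult)

lemma laurent_to_xy_term_mult:
  fixes g :: "'r::comm_ring_1 laurent"
  assumes "\<And>u. coef g u \<noteq> 0 \<Longrightarrow> 0 \<le> P u \<and> 0 \<le> Q u"
  shows "laurent_to_xy (term_xy (lmon d) c * g) = term_xy d c * laurent_to_xy g"
proof (rule poly_mapping_eqI)
  fix u
  have "coef g (lmon u - lmon d) = 0" if "\<not> d \<le> u"
    using that assms[of "lmon u - lmon d"] by (auto simp: coordinates le_iff)
  then show "coef (laurent_to_xy (term_xy (lmon d) c * g)) u = coef (term_xy d c * laurent_to_xy g) u"
    by (auto simp: coef_laurent_to_xy coef_term_mult coef_term_mult_xy lmon_diff)
qed

lemma basis_eq: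
  assumes "m \<in> M"
  shows "basis c m = term_xy (m - ms ! last_index m) 1 * laurent_to_xy (evain_f lt r M c (last_index m))"
proof -
  have "0 \<le> P u \<and> 0 \<le> Q u" if "coef (evain_f lt r M c (last_index m)) u \<noteq> 0" for u
    using evain_f_support[OF last_index_props(1)[OF assms] that] by (auto simp: coordinates)
  from laurent_to_xy_term_mult[OF this] show ?thesis
    by (simp add: basis_def laurent_basis_def last_index_props(2)[OF assms] flip: lmon_diff)
qed

text \<open>
  If the last generator dividing the monomial stays the same, the product is the basis element of the
  next monomial. Otherwise \<open>m e\<close> reaches the exponent \<open>q\<close> of the next generator, and the recursion for
  \<open>f_{i+1}\<close>, multiplied by \<open>m e / m_{i+1}\<close>, expresses the product by the basis element of \<open>m e\<close> and
  those of the monomials \<open>m e r^l\<close>. With \<open>w = lcm(m_i, m_{i+1})\<close> the latter are multiples of \<open>w r^l\<close>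
  with the same \<open>q\<close>, so they lie in \<open>M\<close> and have the same last generator as \<open>w r^l\<close>.
\<close>
lemma laurent_basis_step:
  assumes m: "m \<in> M" and e: "p e = 1 \<and> q e = 0 \<or> p e = 0 \<and> q e = 1"
  shows "term_xy (lmon e) 1 * laurent_basis c m \<in> coeff_span (laurent_basis c ` M)"
proof -
  have me: "m + e \<in> M" using m by (rule up_closed) (simp add: le_iff coordinates)
  define i where "i = last_index m"
  let ?f = "evain_f lt r M c" and ?m = "ms ! i"
  note jm = last_index_props[OF m, folded i_def] and jme = last_index_props[OF me]
  have shift: "term_xy (lmon e) 1 * laurent_basis c m = term_xy (lmon (m + e) - lmon ?m) 1 * ?f i"
  proof -
    have "lmon (m + e) - lmon ?m = lmon e + (lmon m - lmon ?m)" by (simp add: lmon_add)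
    then show ?thesis
      by (simp only: laurent_basis_def i_def[symmetric] mult.assoc[symmetric] mult_single mult_1_left)
  qed
  have "i \<le> last_index (m + e)" using jm by (intro jme(3)) (auto simp: le_iff coordinates)
  show ?thesis
  proof (cases "last_index (m + e) = i")
    case True
    then have "term_xy (lmon e) 1 * laurent_basis c m = laurent_basis c (m + e)"
      unfolding shift by (simp add: laurent_basis_def)
    with me show ?thesis by (simp add: coeff_span_base)
  next
    case False
    let ?m' = "ms ! Suc i"
    have len: "Suc i < length ms" using False \<open>i \<le> last_index (m + e)\<close> jme(1) by simp
    have "q m < q ?m'" using jm(3)[OF len] by force
    moreover have q_me: "q (ms ! last_index (m + e)) \<le> q (m + e)" using jme(2) by (simp add: le_iff)
    ultimately have last_index_me: "last_index (m + e) = Suc i"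
      using gens_mono(1)[of "Suc i" "last_index (m + e)"] jme(1) False \<open>i \<le> last_index (m + e)\<close> e
      by (cases "Suc i < last_index (m + e)") (auto simp: coordinates)
    have q_me: "q (m + e) = q ?m'"
      using q_me \<open>q m < q ?m'\<close> e unfolding last_index_me by (auto simp: coordinates)
    let ?L = "{l. (?m', l) \<in> arrows lt r M}"
    let ?j = "\<lambda>l. last_div lt M (lmon (sup ?m ?m') + rpow r l)"
    let ?T = "\<lambda>l. term_xy (lmon ?m' + rpow r l - lmon (ms ! ?j l)) (c (?m', l)) *
      (if ?j l < Suc i then ?f (?j l) else 0)"
    have T: "term_xy (lmon (m + e) - lmon ?m') 1 * ?T l \<in> coeff_span (laurent_basis c ` M)"
      if l: "l \<in> ?L" for l
    proof -
      from l have l: "(?m', l) \<in> arrows lt r M" by simp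
      obtain w where w: "w \<in> M" "lmon (sup ?m ?m') + rpow r l = lmon w"
        "int (p w) = int (p ?m) + int l * P r" "int (q w) = int (q ?m') + int l * Q r" "0 < l"
        "last_index w < Suc i"
        by (rule arrowD[OF len l])
      have p_m: "p ?m \<le> p m" using jm(2) by (simp add: le_iff)
      have P_nonneg: "0 \<le> P (lmon (m + e) + rpow r l)"
        using w(3) p_m by (simp add: coordinates)
      have Q_nonneg: "0 \<le> Q (lmon (m + e) + rpow r l)"
        using w(4) q_me by (simp add: coordinates)
      from P_nonneg Q_nonneg obtain v where v: "lmon (m + e) + rpow r l = lmon v" by (rule nonneg_lmon)
      have "int (p m) + int (p e) + int l * P r = int (p v)"
        using arg_cong[OF v, of P] by (simp add: coordinates)
      moreover have "int (q (m + e)) + int l * Q r = int (q v)"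
        using arg_cong[OF v, of Q] by (simp add: coordinates)
      ultimately have wv: "p w \<le> p v" "q w = q v" using w(3,4) p_m q_me by linarith+
      then have vM: "v \<in> M" using up_closed[OF w(1)] by (simp add: le_iff)
      have jv: "last_index v = last_index w" using last_index_cong[OF vM w(1)] wv by simp
      have "lmon (m + e) - lmon ?m' + (lmon ?m' + rpow r l - lmon (ms ! last_index w))
          = lmon v - lmon (ms ! last_index v)" unfolding jv by (simp add: v[symmetric])
      then have "term_xy (lmon (m + e) - lmon ?m') 1 * ?T l
          = term_xy (lmon v - lmon (ms ! last_index v)) (c (?m', l)) * ?f (last_index v)"
        by (simp only: w(2,6) jv if_True mult.assoc[symmetric] mult_single mult_1_left)
      also have "\<dots> = scal (c (?m', l)) (laurent_basis c v)"
        by (simp add: laurent_basis_def mult_single flip: mult.assoc)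
      finally show ?thesis using vM by (simp add: coeff_span_scale coeff_span_base)
    qed
    have "laurent_basis c (m + e) = term_xy (lmon (m + e) - lmon ?m') 1 *
        (term_xy (lmon ?m' - lmon ?m) 1 * ?f i + (\<Sum>l\<in>?L. ?T l))"
      by (simp add: laurent_basis_def last_index_me Let_def)
    also have "\<dots> = term_xy (lmon e) 1 * laurent_basis c m
        + (\<Sum>l\<in>?L. term_xy (lmon (m + e) - lmon ?m') 1 * ?T l)"
      unfolding shift distrib_left sum_distrib_left by (simp add: mult_single flip: mult.assoc)
    finally have "term_xy (lmon e) 1 * laurent_basis c m = laurent_basis c (m + e)
        - (\<Sum>l\<in>?L. term_xy (lmon (m + e) - lmon ?m') 1 * ?T l)"
      by (rule add_implies_diff[OF sym])
    also have "\<dots> \<in> coeff_span (laurent_basis c ` M)"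
      by (rule coeff_span_diff[OF coeff_span_base[OF imageI[OF me]] coeff_span_sum[OF T]])
    finally show ?thesis .
  qed
qed

lemma laurent_to_xy_span:
  assumes "x \<in> coeff_span (laurent_basis c ` M)"
  shows "laurent_to_xy x \<in> coeff_span (basis c ` M)"
  using assms
proof (induction rule: coeff_span_induct)
  case zero
  have "laurent_to_xy 0 = (0 :: 'a xy)" by (rule poly_mapping_eqI) (simp add: coef_laurent_to_xy)
  then show ?case by (simp add: coeff_span_zero)
next
  case (step k x y)
  have "laurent_to_xy (scal k x + y) = scal k (laurent_to_xy x) + laurent_to_xy y"
    by (rule poly_mapping_eqI) (simp add: coef_laurent_to_xy lookup_add coef_const_mult)
  moreover have "laurent_to_xy x \<in> basis c ` M" using step by (auto simp: basis_def)
  ultimately show ?case using step by (simp add: coeff_span_add coeff_span_scale coeff_span_base)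
qed

theorem unitriangular: "unitriangular_family lt \<alpha> \<beta> M (basis c)"
proof
  fix m assume m: "m \<in> M"
  show "coef (basis c m) m = 1"
    using laurent_basis_leading_coefficient[OF m] by (simp add: basis_def coef_laurent_to_xy)
  {
    fix u assume "u \<in> supp (basis c m)"
    then have "coef (laurent_basis c m) (lmon u) \<noteq> 0"
      by (simp add: basis_def coef_laurent_to_xy in_keys_iff)
    note support = laurent_basis_support[OF m this]
    show "deg \<alpha> \<beta> u = deg \<alpha> \<beta> m" using support(4) by (simp add: laurent_deg_simps)
    show "lt u m" if "u \<noteq> m"
      using support(3) that by (simp add: lmon_eq_iff lt_iff coordinates)
  }
  fix e :: mon assume "e \<in> {(1, 0), (0, 1)}"
  then have e: "p e = 1 \<and> q e = 0 \<or> p e = 0 \<and> q e = 1" using orientation by auto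
  have "term_xy e 1 * basis c m = laurent_to_xy (term_xy (lmon e) 1 * laurent_basis c m)"
    unfolding basis_def
    by (rule laurent_to_xy_term_mult[symmetric]) (use laurent_basis_support[OF m] in fastforce)
  with laurent_to_xy_span[OF laurent_basis_step[OF m e]]
  show "term_xy e 1 * basis c m \<in> coeff_span (basis c ` M)" by simp
next
  have "{(u, v). lt u v} \<subseteq> inv_image (less_than <*lex*> less_than) (\<lambda>u. (q u, p u))"
    by (auto simp: lt_iff inv_image_def)
  then show "wf {(u, v). lt u v}" by (rule wf_subset[rotated]) (auto intro: wf_inv_image)
qed (use pos in \<open>auto simp: lt_iff eq_iff\<close>)

definition family :: "(mon \<times> nat \<Rightarrow> 'r::comm_ring_1) \<Rightarrow> 'r xy set" where
  "family c = {laurent_to_xy (evain_f lt r M c i) | i. i < length ms}"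

lemma basis_gen: "i < length ms \<Longrightarrow> basis c (ms ! i) = laurent_to_xy (evain_f lt r M c i)"
  by (simp add: basis_def laurent_basis_def last_index_gen)

lemma family_eq: "family c = basis c ` mingens M"
proof -
  have "family c = (\<lambda>i. basis c (ms ! i)) ` {..<length ms}"
    by (auto simp: family_def basis_gen image_iff)
  also have "\<dots> = basis c ` mingens M"
    using gens_props by (metis image_image lessThan_atLeast0 list.set_map map_nth set_upt)
  finally show ?thesis .
qed

lemma ideal_gen_family:
  "ideal_gen (family c \<union> const_xy ` \<aa>) = ideal_gen (basis c ` M \<union> const_xy ` \<aa>)" (is "?I = ?J")
proof
  have "mingens M \<subseteq> M" by (auto simp: mingens_def)
  then show "?I \<subseteq> ?J" unfolding family_eq
    by (intro ideal_gen_minimal ideal_gen_is_ideal) (auto intro: ideal_gen_base)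
  have "basis c m \<in> ?I" if "m \<in> M" for m
    unfolding basis_eq[OF that] using last_index_props(1)[OF that]
    by (intro ideal_mult[OF ideal_gen_is_ideal] ideal_gen_base) (auto simp: family_def)
  then show "?J \<subseteq> ?I"
    by (intro ideal_gen_minimal ideal_gen_is_ideal) (auto intro: ideal_gen_base)
qed

text \<open>
  With \<open>S\<close> the polynomials in the coordinates of a cell, this places the division of the universal
  generators into the right polynomial ring; \<open>map_basis\<close> below then specialises its result.
\<close>
lemma evain_f_coefficients:
  assumes S: "is_subring S" and c: "\<And>a. a \<in> arrows lt r M \<Longrightarrow> c a \<in> S"
  shows "coef (evain_f lt r M c i) u \<in> S"
proof (induction i arbitrary: u rule: less_induct)
  case (less i)
  note S' = is_subringD[OF S]
  show ?case
  proof (cases i)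
    case 0
    then show ?thesis using S' by (simp add: lookup_single when_def)
  next
    case (Suc k)
    have sum: "(\<Sum>x\<in>X. h x) \<in> S" if "\<And>x. x \<in> X \<Longrightarrow> h x \<in> S" for X :: "nat set" and h
      using that S' by (induction X rule: infinite_finite_induct) auto
    show ?thesis
      unfolding Suc evain_f.simps Let_def lookup_add lookup_sum coef_term_mult
      using less.IH Suc c S' by (intro S' sum) (auto)
  qed
qed

lemma basis_coefficients:
  assumes "is_subring S" "\<And>a. a \<in> arrows lt r M \<Longrightarrow> c a \<in> S"
  shows "coef (basis c m) u \<in> S"
  using evain_f_coefficients[OF assms] is_subringD[OF assms(1)]
  by (simp add: basis_def laurent_basis_def coef_laurent_to_xy coef_term_mult)

lemma map_basis:
  assumes "ring_map \<theta>"
  shows "Poly_Mapping.map \<theta> (basis c m) = basis (\<lambda>a. \<theta> (c a)) m"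
proof -
  interpret ring_map \<theta> by fact
  have "Poly_Mapping.map \<theta> (evain_f lt r M c i) = evain_f lt r M (\<lambda>a. \<theta> (c a)) i" for i
  proof (induction i rule: less_induct)
    case (less i)
    show ?case
    proof (cases i)
      case (Suc k)
      with less show ?thesis
        by (simp add: Let_def map_plus map_times map_sum map_term one map_zero if_distrib cong: if_cong)
    qed (simp add: map_term one)
  qed
  then have "Poly_Mapping.map \<theta> (laurent_basis c m) = laurent_basis (\<lambda>a. \<theta> (c a)) m"
    by (simp add: laurent_basis_def map_times map_term one)
  then have "\<theta> (coef (laurent_basis c m) u) = coef (laurent_basis (\<lambda>a. \<theta> (c a)) m) u" for u
    using lookup_map_hom[of \<theta> "laurent_basis c m" u] by (simp add: zero)
  then show ?thesis
    by (intro poly_mapping_eqI) (simp add: basis_def coef_laurent_to_xy lookup_map_hom zero)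
qed

end

section \<open>Hilbert functions of monomial ideals\<close>

lemma mem_monomial_ideal_iff:
  fixes I :: "'k::field xy set"
  assumes "monomial_ideal I"
  shows "p \<in> I \<longleftrightarrow> supp p \<subseteq> mons I"
proof -
  obtain S where S: "I = ideal_gen ((\<lambda>m. term_xy m 1) ` S)"
    using assms by (auto simp: monomial_ideal_def)
  then have ideal: "is_ideal I" by (simp add: ideal_gen_is_ideal)
  let ?J = "{p :: 'k xy. supp p \<subseteq> mons I}"
  have up: "d + u \<in> mons I" if "u \<in> mons I" for d u
  proof -
    have "term_xy d 1 * term_xy u (1::'k) \<in> I"
      using that by (intro ideal_mult[OF ideal]) (simp add: mons_def)
    then show ?thesis by (simp add: mons_def mult_single)
  qed
  have "is_ideal ?J"
  proof (rule Modules.module.subspaceI[OF ideal_module])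
    fix x y assume "x \<in> ?J" "y \<in> ?J"
    then show "x + y \<in> ?J" using Poly_Mapping.keys_add[of x y] by blast
  next
    fix c x assume "x \<in> ?J"
    then show "c * x \<in> ?J" using keys_mult[of c x] up by blast
  qed simp
  moreover have "(\<lambda>m. term_xy m 1) ` S \<subseteq> ?J"
    unfolding S by (auto simp: mons_def intro: ideal_gen_base)
  ultimately have "I \<subseteq> ?J" unfolding S by (intro ideal_gen_minimal)
  moreover have "p \<in> I" if "supp p \<subseteq> mons I" for p
  proof -
    have "(\<Sum>u\<in>supp p. scal (coef p u) (term_xy u 1)) \<in> I"
      using that by (intro ideal_sum[OF ideal] ideal_mult[OF ideal]) (auto simp: mons_def)
    then show ?thesis by (simp add: mult_single flip: sum_of_terms)
  qed
  ultimately show ?thesis by blast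
qed

lemma mons_up_closed:
  fixes I :: "'k::field xy set"
  assumes "monomial_ideal I" "m \<in> mons I" "m \<le> m'"
  shows "m' \<in> mons I"
proof -
  have ideal: "is_ideal I" using assms(1) by (auto simp: monomial_ideal_def ideal_gen_is_ideal)
  have "term_xy (m' - m) 1 * term_xy m (1::'k) \<in> I"
    using assms(2) by (intro ideal_mult[OF ideal]) (simp add: mons_def)
  moreover have "m' - m + m = m'" using assms(3) by (auto simp: less_eq_prod_def prod_eq_iff)
  ultimately show ?thesis by (simp add: mons_def mult_single)
qed

text \<open>
  Restricting polynomials of degree \<open>a\<close> to the standard monomials has kernel \<open>I\<close> in that degree. It
  turns a basis of the quotient into a basis of the space spanned by the standard monomials.
\<close>
lemma hilbert_function_monomial_ideal:
  fixes I :: "'k::field xy set"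
  assumes pos: "0 < \<alpha>" "0 < \<beta>" and I: "monomial_ideal I" and H: "has_hilbert_function \<alpha> \<beta> I H"
  shows "H a = card {s. s \<notin> mons I \<and> deg \<alpha> \<beta> s = a}"
proof -
  interpret V: vector_space "scal :: 'k \<Rightarrow> 'k xy \<Rightarrow> 'k xy"
    by unfold_locales (simp_all add: algebra_simps single_add mult_single flip: mult.assoc)
  let ?S = "{s. s \<notin> mons I \<and> deg \<alpha> \<beta> s = a}"
  have fin: "finite ?S" by (rule finite_subset[OF _ finite_degree[OF pos, of a]]) auto
  obtain vs where len: "length vs = H a" and vs: "graded_basis \<alpha> \<beta> I a vs"
    using H by (auto simp: has_hilbert_function_def)
  note mem = mem_monomial_ideal_iff[OF I]
  have ideal: "is_ideal I" using I by (auto simp: monomial_ideal_def ideal_gen_is_ideal)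
  define res where "res p = (\<Sum>s\<in>?S. term_xy s (coef p s))" for p :: "'k xy"
  have coef_res: "coef (res p) u = (if u \<in> ?S then coef p u else 0)" for p u
    unfolding res_def by (rule coef_sum_terms[OF fin])
  have res_zero: "res p = 0 \<longleftrightarrow> p \<in> I" if "homogeneous_of \<alpha> \<beta> a p" for p
  proof -
    have "res p = 0 \<longleftrightarrow> (\<forall>u\<in>?S. coef p u = 0)"
      by (auto simp: poly_mapping_eq_iff fun_eq_iff coef_res)
    also have "\<dots> \<longleftrightarrow> p \<in> I"
      unfolding mem using that by (auto simp: homogeneous_of_def in_keys_iff)
    finally show ?thesis .
  qed
  define w where "w i = res (vs ! i)" for i
  have comb: "homogeneous_of \<alpha> \<beta> a (\<Sum>i<H a. const_xy (c i) * vs ! i)" for c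
  proof -
    have "coef (vs ! i) u = 0" if "i < H a" "deg \<alpha> \<beta> u \<noteq> a" for i u
    proof -
      have "vs ! i \<in> set vs" using that(1) len by simp
      then have "homogeneous_of \<alpha> \<beta> a (vs ! i)" using vs by (simp add: graded_basis_def)
      then show ?thesis using that(2) by (auto simp: homogeneous_of_def in_keys_iff)
    qed
    then show ?thesis
      by (auto simp: homogeneous_of_def in_keys_iff lookup_sum coef_const_mult
          intro: ccontr dest: sum.not_neutral_contains_not_neutral)
  qed
  have res_comb: "res (\<Sum>i<H a. const_xy (c i) * vs ! i) = (\<Sum>i<H a. scal (c i) (w i))" for c
    by (rule poly_mapping_eqI) (simp add: coef_res w_def lookup_sum coef_const_mult)
  have w_indep: "\<forall>i<H a. c i = 0" if "(\<Sum>i<H a. scal (c i) (w i)) = 0" for c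
    using vs len that res_zero[OF comb] res_comb by (simp add: graded_basis_def)
  have inj: "inj_on w {..<H a}"
  proof (rule inj_onI, rule ccontr)
    fix i j assume ij: "i \<in> {..<H a}" "j \<in> {..<H a}" "w i = w j" "i \<noteq> j"
    have "(\<Sum>k<H a. scal ((if k = i then 1 else 0) - (if k = j then 1 else 0)) (w k))
        = (\<Sum>k<H a. (if k = i then w k else 0) - (if k = j then w k else 0))"
      by (intro sum.cong) (auto simp: single_diff algebra_simps)
    also have "\<dots> = w i - w j" using ij(1,2) by (simp add: sum_subtractf)
    finally have "(\<Sum>k<H a. scal ((if k = i then 1 else 0) - (if k = j then 1 else 0)) (w k)) = 0"
      using ij(3) by simp
    from w_indep[OF this] ij show False by auto
  qed
  have "u (w i) = 0" if "(\<Sum>i<H a. scal (u (w i)) (w i)) = 0" "i < H a" for u :: "'k xy \<Rightarrow> 'k" and i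
    using w_indep[of "\<lambda>i. u (w i)"] that by blast
  then have indep_w: "V.independent (w ` {..<H a})"
    unfolding V.dependent_finite[OF finite_imageI[OF finite_lessThan]]
    by (auto simp: sum.reindex[OF inj])
  have indep_std: "V.independent ((\<lambda>s. term_xy s (1::'k)) ` ?S)"
  proof -
    have inj: "inj_on (\<lambda>s. term_xy s (1::'k)) ?S"
      by (rule inj_onI) (drule arg_cong[where f = supp], simp)
    have "u (term_xy s 1) = 0" if "(\<Sum>s\<in>?S. scal (u (term_xy s 1)) (term_xy s 1)) = 0" "s \<in> ?S"
      for u :: "'k xy \<Rightarrow> 'k" and s
    proof -
      have "(\<Sum>s\<in>?S. term_xy s (u (term_xy s 1))) = 0" using that(1) by (simp add: mult_single)
      from arg_cong[OF this, of "\<lambda>p. coef p s"] that(2) show ?thesis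
        by (simp add: coef_sum_terms[OF fin])
    qed
    then show ?thesis
      unfolding V.dependent_finite[OF finite_imageI[OF fin]] by (auto simp: sum.reindex[OF inj])
  qed
  have span_eq: "V.span (w ` {..<H a}) = V.span ((\<lambda>s. term_xy s (1::'k)) ` ?S)"
    unfolding V.span_eq
  proof (intro conjI subsetI)
    fix x assume "x \<in> w ` {..<H a}"
    then obtain i where x: "x = res (vs ! i)" by (auto simp: w_def)
    have "(\<Sum>s\<in>?S. scal (coef (vs ! i) s) (term_xy s 1)) \<in> V.span ((\<lambda>s. term_xy s 1) ` ?S)"
      by (intro V.span_sum V.span_scale V.span_base) auto
    then show "x \<in> V.span ((\<lambda>s. term_xy s 1) ` ?S)" by (simp add: x res_def mult_single)
  next
    fix x assume "x \<in> (\<lambda>s. term_xy s (1::'k)) ` ?S"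
    then obtain s where s: "s \<in> ?S" "x = term_xy s 1" by blast
    then have hom: "homogeneous_of \<alpha> \<beta> a x" by (simp add: homogeneous_of_def)
    then obtain c where c: "x - (\<Sum>i<H a. const_xy (c i) * vs ! i) \<in> I"
      using vs len by (auto simp: graded_basis_def)
    have "homogeneous_of \<alpha> \<beta> a (x - (\<Sum>i<H a. const_xy (c i) * vs ! i))"
      using hom comb[of c] by (auto simp: homogeneous_of_def in_keys_iff lookup_minus)
    with c have "res (x - (\<Sum>i<H a. const_xy (c i) * vs ! i)) = 0" by (simp add: res_zero)
    moreover have "res (x - y) = res x - res y" for y
      by (rule poly_mapping_eqI) (simp add: coef_res lookup_minus)
    moreover have "res x = x"
      by (rule poly_mapping_eqI) (use s in \<open>auto simp: coef_res lookup_single when_def\<close>)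
    ultimately have "x = (\<Sum>i<H a. scal (c i) (w i))" by (simp add: res_comb)
    also have "\<dots> \<in> V.span (w ` {..<H a})"
      by (intro V.span_sum V.span_scale V.span_base) auto
    finally show "x \<in> V.span (w ` {..<H a})" .
  qed
  have "card (w ` {..<H a}) = card ((\<lambda>s. term_xy s (1::'k)) ` ?S)"
    by (rule trans[OF V.dim_eq_card[OF refl indep_w, symmetric] V.dim_eq_card[OF span_eq[symmetric] indep_std]])
  moreover have "inj_on (\<lambda>s. term_xy s (1::'k)) ?S"
    by (rule inj_onI) (drule arg_cong[where f = supp], simp)
  ultimately show ?thesis using inj by (simp add: card_image)
qed

section \<open>Inclusion of ideals with equal Hilbert functions\<close>

text \<open>
  In degree \<open>a\<close> let \<open>B\<close> express the standard monomials of \<open>M\<close> by those of \<open>M'\<close> modulo the smaller ideal,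
  and let \<open>C\<close> express the latter by the former modulo the larger one. Modulo the larger ideal both
  relations hold, so \<open>B C\<close> is the identity modulo \<open>\<aa>\<close>. If \<open>p\<close> lies in the larger ideal and has normal
  form \<open>e\<close> modulo the smaller one, then \<open>e C\<close> vanishes modulo \<open>\<aa>\<close>, hence so does \<open>e\<close>.
\<close>
lemma cell_ideals_eq_of_subset:
  fixes G G' :: "mon \<Rightarrow> 'r::comm_ring_1 xy"
  assumes X: "unitriangular_family lt \<alpha> \<beta> M G" and Y: "unitriangular_family lt' \<alpha> \<beta> M' G'"
    and \<aa>: "is_ideal \<aa>"
    and card: "\<And>a. card {s. s \<notin> M \<and> deg \<alpha> \<beta> s = a} = card {s. s \<notin> M' \<and> deg \<alpha> \<beta> s = a}"
    and sub: "ideal_gen (G' ` M' \<union> const_xy ` \<aa>) \<subseteq> ideal_gen (G ` M \<union> const_xy ` \<aa>)"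
  shows "ideal_gen (G ` M \<union> const_xy ` \<aa>) = ideal_gen (G' ` M' \<union> const_xy ` \<aa>)" (is "?I = ?I'")
proof
  interpret X: unitriangular_family lt \<alpha> \<beta> M G by fact
  interpret Y: unitriangular_family lt' \<alpha> \<beta> M' G' by fact
  note I = ideal_gen_is_ideal[of "G ` M \<union> const_xy ` \<aa>"]
  note I' = ideal_gen_is_ideal[of "G' ` M' \<union> const_xy ` \<aa>"]
  have homogeneous: "p \<in> ?I'" if p: "p \<in> ?I" "homogeneous_of \<alpha> \<beta> a p" for p a
  proof -
    let ?S = "{s. s \<notin> M \<and> deg \<alpha> \<beta> s = a}" and ?T = "{s. s \<notin> M' \<and> deg \<alpha> \<beta> s = a}"
    have fin: "finite ?S" "finite ?T"
      by (rule finite_subset[OF _ finite_degree[OF X.pos, of a]]; auto)+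
    have hom: "homogeneous_of \<alpha> \<beta> a (term_xy u (1::'r))" if "deg \<alpha> \<beta> u = a" for u
      using that by (simp add: homogeneous_of_def)
    obtain e where e: "p - (\<Sum>t\<in>?T. term_xy t (e t)) \<in> ?I'"
      using Y.standard_mod_ideal[OF p(2)] by blast
    have "\<forall>t\<in>?T. \<exists>c. term_xy t 1 - (\<Sum>s\<in>?S. term_xy s (c s)) \<in> ?I"
      using X.standard_mod_ideal[OF hom] by blast
    from bchoice[OF this] obtain C
      where C: "\<forall>t\<in>?T. term_xy t 1 - (\<Sum>s\<in>?S. term_xy s (C t s)) \<in> ?I" ..
    have "\<forall>s\<in>?S. \<exists>b. term_xy s 1 - (\<Sum>t\<in>?T. term_xy t (b t)) \<in> ?I'"
      using Y.standard_mod_ideal[OF hom] by blast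
    from bchoice[OF this] obtain B
      where B: "\<forall>s\<in>?S. term_xy s 1 - (\<Sum>t\<in>?T. term_xy t (B s t)) \<in> ?I'" ..
    \<comment> \<open>Rewriting standard monomials of \<open>M'\<close> by those of \<open>M\<close> is multiplication by the matrix \<open>C\<close>.\<close>
    have substitute: "(\<Sum>t\<in>?T. term_xy t (d t)) - (\<Sum>s\<in>?S. term_xy s (\<Sum>t\<in>?T. d t * C t s)) \<in> ?I" for d
    proof -
      have single_sum: "term_xy s (\<Sum>t\<in>?T. g t) = (\<Sum>t\<in>?T. term_xy s (g t))" for s and g :: "mon \<Rightarrow> 'r"
        by (rule poly_mapping_eqI) (simp add: lookup_sum lookup_single when_def)
      have "(\<Sum>t\<in>?T. scal (d t) (term_xy t 1 - (\<Sum>s\<in>?S. term_xy s (C t s)))) \<in> ?I"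
        by (intro ideal_sum[OF I] ideal_mult[OF I] C[rule_format])
      also have "(\<Sum>t\<in>?T. scal (d t) (term_xy t 1 - (\<Sum>s\<in>?S. term_xy s (C t s))))
          = (\<Sum>t\<in>?T. term_xy t (d t)) - (\<Sum>t\<in>?T. \<Sum>s\<in>?S. term_xy s (d t * C t s))"
        by (simp add: right_diff_distrib sum_subtractf sum_distrib_left mult_single)
      also have "(\<Sum>t\<in>?T. \<Sum>s\<in>?S. term_xy s (d t * C t s))
          = (\<Sum>s\<in>?S. term_xy s (\<Sum>t\<in>?T. d t * C t s))"
        unfolding single_sum by (rule sum.swap)
      finally show ?thesis .
    qed
    have BC: "(\<Sum>t\<in>?T. B s t * C t s') - (if s = s' then 1 else 0) \<in> \<aa>"
      if s: "s \<in> ?S" "s' \<in> ?S" for s s'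
    proof -
      have "(term_xy s 1 - (\<Sum>t\<in>?T. term_xy t (B s t)))
          + ((\<Sum>t\<in>?T. term_xy t (B s t)) - (\<Sum>s'\<in>?S. term_xy s' (\<Sum>t\<in>?T. B s t * C t s'))) \<in> ?I"
        by (rule ideal_add[OF I subsetD[OF sub bspec[OF B s(1)]] substitute])
      then have "- term_xy 0 1 * (term_xy s 1 - (\<Sum>s'\<in>?S. term_xy s' (\<Sum>t\<in>?T. B s t * C t s'))) \<in> ?I"
        by (intro ideal_mult[OF I]) simp
      also have "- term_xy 0 1 * (term_xy s 1 - (\<Sum>s'\<in>?S. term_xy s' (\<Sum>t\<in>?T. B s t * C t s')))
          = (\<Sum>s'\<in>?S. term_xy s' ((\<Sum>t\<in>?T. B s t * C t s') - (if s = s' then 1 else 0)))"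
        by (rule poly_mapping_eqI)
          (use s in \<open>auto simp: coef_sum_terms[OF fin(1)] lookup_minus lookup_single when_def\<close>)
      finally show ?thesis using s(2) fin by (intro X.standard_independent[OF \<aa>, of ?S]) auto
    qed
    have eC: "(\<Sum>t\<in>?T. e t * C t s) \<in> \<aa>" if s: "s \<in> ?S" for s
    proof -
      have "p - (p - (\<Sum>t\<in>?T. term_xy t (e t)))
          - ((\<Sum>t\<in>?T. term_xy t (e t)) - (\<Sum>s\<in>?S. term_xy s (\<Sum>t\<in>?T. e t * C t s))) \<in> ?I"
        by (rule ideal_diff[OF I ideal_diff[OF I p(1) subsetD[OF sub e]] substitute])
      then have "(\<Sum>s\<in>?S. term_xy s (\<Sum>t\<in>?T. e t * C t s)) \<in> ?I" by simp
      then show ?thesis using s fin by (intro X.standard_independent[OF \<aa>, of ?S]) auto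
    qed
    have "e t \<in> \<aa>" if "t \<in> ?T" for t
      by (rule solution_in_ideal[OF \<aa> fin card BC eC that])
    then have "(\<Sum>t\<in>?T. term_xy t 1 * const_xy (e t)) \<in> ?I'"
      by (intro ideal_sum[OF I'] ideal_mult[OF I'] ideal_gen_base) auto
    from ideal_add[OF I' e this] show ?thesis by (simp add: mult_single)
  qed
  show "?I \<subseteq> ?I'"
  proof
    fix p assume p: "p \<in> ?I"
    have "(\<Sum>a\<in>deg \<alpha> \<beta> ` supp p. hom_part \<alpha> \<beta> a p) \<in> ?I'"
      using X.homogeneous_ideal_gen[OF \<aa>] p
      by (intro ideal_sum[OF I'] homogeneous[OF _ homogeneous_hom_part]) (auto simp: homogeneous_ideal_def)
    then show "p \<in> ?I'" by (simp flip: sum_hom_parts)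
  qed
qed (rule sub)

section \<open>Ideals of polynomials in the coordinates\<close>

lemma is_subring_polys_in: "is_subring (polys_in V :: ('v, 'k::comm_ring_1) mpoly set)"
  unfolding is_subring_def
proof (intro conjI ballI)
  fix p q :: "('v, 'k) mpoly" assume pq: "p \<in> polys_in V" "q \<in> polys_in V"
  have "supp (p + q) \<subseteq> supp p \<union> supp q" by (rule Poly_Mapping.keys_add)
  then show "p + q \<in> polys_in V" using pq by (auto simp: polys_in_def)
  have "supp (p - q) \<subseteq> supp p \<union> supp q" by (auto simp: in_keys_iff lookup_minus)
  then show "p - q \<in> polys_in V" using pq by (auto simp: polys_in_def)
  show "p * q \<in> polys_in V"
    unfolding polys_in_def
  proof (intro CollectI ballI)
    fix e assume "e \<in> supp (p * q)"
    then obtain c d where "e = c + d" "c \<in> supp p" "d \<in> supp q" using keys_mult by fast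
    then show "supp e \<subseteq> V" using pq Poly_Mapping.keys_add[of c d] by (fastforce simp: polys_in_def)
  qed
qed (auto simp: polys_in_def)

lemma mvar_in_polys_in: "v \<in> V \<Longrightarrow> mvar v \<in> polys_in V"
  by (auto simp: mvar_def polys_in_def)

lemma ideal_gen_in_is_ideal:
  fixes B :: "('v, 'k::comm_ring_1) mpoly set"
  assumes "B \<subseteq> polys_in V"
  shows "ideal_of_polys_in V (ideal_gen_in V B)"
  unfolding ideal_of_polys_in_def
proof (intro conjI ballI subsetI)
  note sub = is_subringD[OF is_subring_polys_in[of V, where ?'k = 'k]]
  {
    fix x assume "x \<in> ideal_gen_in V B"
    then obtain S q where S: "finite S" "S \<subseteq> B" "\<forall>p\<in>S. q p \<in> polys_in V" "x = (\<Sum>p\<in>S. q p * p)"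
      by (auto simp: ideal_gen_in_def)
    have "(\<Sum>p\<in>S. q p * p) \<in> polys_in V"
      using S(1-3) assms by (induction S) (auto intro!: sub)
    then show "x \<in> polys_in V" by (simp add: S(4))
    fix c :: "('v, 'k) mpoly" assume c: "c \<in> polys_in V"
    have "c * x = (\<Sum>p\<in>S. c * q p * p)" by (simp add: S(4) sum_distrib_left mult.assoc)
    moreover have "\<forall>p\<in>S. c * q p \<in> polys_in V" using c S(3) by (auto intro: sub)
    ultimately show "c * x \<in> ideal_gen_in V B" 
      unfolding ideal_gen_in_def using S(1,2)
      by (intro CollectI exI[of _ S] exI[of _ "\<lambda>p. c * q p"] conjI)
  }
  show "0 \<in> ideal_gen_in V B" unfolding ideal_gen_in_def
    by (intro CollectI exI[of _ "{}"]) auto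
  fix x y assume "x \<in> ideal_gen_in V B" "y \<in> ideal_gen_in V B"
  then obtain S q T q' where S: "finite S" "S \<subseteq> B" "\<forall>p\<in>S. q p \<in> polys_in V" "x = (\<Sum>p\<in>S. q p * p)"
    and T: "finite T" "T \<subseteq> B" "\<forall>p\<in>T. q' p \<in> polys_in V" "y = (\<Sum>p\<in>T. q' p * p)"
    by (auto simp: ideal_gen_in_def)
  define c where "c p = (if p \<in> S then q p else 0) + (if p \<in> T then q' p else 0)" for p
  have "x = (\<Sum>p\<in>S \<union> T. (if p \<in> S then q p else 0) * p)"
    unfolding S(4) using S(1) T(1) by (intro sum.mono_neutral_cong_left) auto
  moreover have "y = (\<Sum>p\<in>S \<union> T. (if p \<in> T then q' p else 0) * p)"
    unfolding T(4) using S(1) T(1) by (intro sum.mono_neutral_cong_left) auto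
  ultimately have "x + y = (\<Sum>p\<in>S \<union> T. c p * p)"
    by (simp only: c_def distrib_right sum.distrib)
  moreover have "\<forall>p\<in>S \<union> T. c p \<in> polys_in V"
    using S(3) T(3) by (auto simp: c_def intro: sub)
  ultimately show "x + y \<in> ideal_gen_in V B"
    unfolding ideal_gen_in_def using S(1,2) T(1,2)
    by (intro CollectI exI[of _ "S \<union> T"] exI[of _ c]) auto
qed

lemma ideal_gen_in_base:
  assumes "b \<in> B"
  shows "b \<in> ideal_gen_in V B"
  unfolding ideal_gen_in_def
  using assms is_subringD(2)[OF is_subring_polys_in[of V]]
  by (intro CollectI exI[of _ "{b}"] exI[of _ "\<lambda>_. 1"]) auto

lemma ring_map_of_int: "ring_map (of_int :: int \<Rightarrow> 'r::comm_ring_1)"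
  by unfold_locales simp_all

lemma ring_map_const: "ring_map (term_xy 0 :: 'k::comm_ring_1 \<Rightarrow> ('m::comm_monoid_add \<Rightarrow>\<^sub>0 'k))"
  by unfold_locales (simp_all add: single_add mult_single)

lemma eval_int_image:
  fixes t :: "'v \<Rightarrow> ('z, 'k::comm_ring_1) mpoly"
  shows "eval_mpoly (term_xy 0) t (int_image p) = eval_mpoly of_int t p"
proof -
  have "supp (int_image p :: ('v, 'k) mpoly) \<subseteq> supp p"
    by (auto simp: int_image_def in_keys_iff lookup_map_hom)
  moreover have "of_int k = (0 :: ('z, 'k) mpoly)" if "of_int k = (0 :: 'k)" for k
    using that by (metis single_of_int single_zero)
  ultimately show ?thesis
    unfolding eval_mpoly_def
    by (intro sum.mono_neutral_cong_left)
      (auto simp: int_image_def in_keys_iff lookup_map_hom)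
qed

lemma int_image_in_polys_in: "p \<in> polys_in V \<Longrightarrow> (int_image p :: ('v, 'k::comm_ring_1) mpoly) \<in> polys_in V"
  by (auto simp: polys_in_def int_image_def in_keys_iff lookup_map_hom)

lemma vanish_on_ideal_gen_in_iff:
  fixes \<theta> :: "('v, 'k::comm_ring_1) mpoly \<Rightarrow> 'r::comm_ring_1"
  assumes "ring_map \<theta>" "is_ideal \<aa>"
  shows "(\<forall>p\<in>ideal_gen_in V B. \<theta> p \<in> \<aa>) \<longleftrightarrow> (\<forall>b\<in>B. \<theta> b \<in> \<aa>)"
proof -
  interpret ring_map \<theta> by fact
  have "\<theta> p \<in> \<aa>" if "p \<in> ideal_gen_in V B" "\<forall>b\<in>B. \<theta> b \<in> \<aa>" for p
  proof -
    from that(1) obtain S q where S: "S \<subseteq> B" "p = (\<Sum>x\<in>S. q x * x)"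
      by (auto simp: ideal_gen_in_def)
    have "(\<Sum>x\<in>S. \<theta> (q x) * \<theta> x) \<in> \<aa>"
      using that(2) S(1) by (intro ideal_sum[OF assms(2)] ideal_mult[OF assms(2)]) blast
    then show ?thesis by (simp add: S(2) sum times)
  qed
  then show ?thesis using ideal_gen_in_base by blast
qed

section \<open>The ideal of the edge-scheme\<close>

context staircase
begin

lemma pullback_family:
  assumes "ring_map \<theta>"
  shows "pullback_ideal \<theta> \<aa> (family c) = ideal_gen (basis (\<lambda>a. \<theta> (c a)) ` M \<union> const_xy ` \<aa>)"
proof -
  have "Poly_Mapping.map \<theta> ` family c = family (\<lambda>a. \<theta> (c a))"
    unfolding family_eq image_image using map_basis[OF assms] by simp
  then show ?thesis by (simp add: pullback_ideal_def ideal_gen_family)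
qed

end

theorem theorem1p4:
  fixes M N :: "'k::field xy set" and \<alpha> \<beta> :: nat and H :: "nat \<Rightarrow> nat"
  assumes "0 < \<alpha>" and "0 < \<beta>" and "coprime \<alpha> \<beta>"
    and "monomial_ideal M" and "finite_colength M"
    and "monomial_ideal N" and "finite_colength N"
    and "has_hilbert_function \<alpha> \<beta> M H" and "has_hilbert_function \<alpha> \<beta> N H"
    and "dominates \<alpha> \<beta> (mons M) (mons N)"
  shows "\<exists>F :: mon \<Rightarrow> mon \<Rightarrow> (evar, int) mpoly.
    (\<forall>n s. F n s \<in> polys_in (edge_vars \<alpha> \<beta> (mons M) (mons N))) \<and>
    is_edge_ideal TYPE('z::infinite) \<alpha> \<beta> H M N
      (ideal_gen_in (edge_vars \<alpha> \<beta> (mons M) (mons N))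
        {int_image (F n s) | n s.
           n \<in> mingens (mons N) \<and> s \<notin> mons M \<and> deg \<alpha> \<beta> s = deg \<alpha> \<beta> n})"
proof -
  interpret X: staircase lex "r_vec \<alpha> \<beta>" fst snd fst snd \<alpha> \<beta> "mons M"
    using assms mons_up_closed[of M] by unfold_locales auto
  interpret Y: staircase lex_opp "r_inv_vec \<alpha> \<beta>" snd fst snd fst \<alpha> \<beta> "mons N"
    using assms mons_up_closed[of N] by unfold_locales auto
  let ?V = "edge_vars \<alpha> \<beta> (mons M) (mons N)"
  let ?cx = "\<lambda>a. mvar (Inl a) :: (evar, int) mpoly" and ?cy = "\<lambda>a. mvar (Inr a) :: (evar, int) mpoly"
  let ?std = "\<lambda>n. {s. s \<notin> mons M \<and> deg \<alpha> \<beta> s = deg \<alpha> \<beta> n}"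
  let ?mon = "\<lambda>n. {m. m \<in> mons M \<and> deg \<alpha> \<beta> m = deg \<alpha> \<beta> n}"
  note H_M = hilbert_function_monomial_ideal[OF assms(1,2,4,8)]
  note H_N = hilbert_function_monomial_ideal[OF assms(1,2,6,9)]
  have mingens_N: "n \<in> mons N" if "n \<in> mingens (mons N)" for n
    using that by (simp add: mingens_def)
  \<comment> \<open>Division of the universal generators of \<open>I'\<close> over the integers.\<close>
  have "\<forall>n\<in>mingens (mons N). \<exists>e. (\<forall>u. e u \<in> polys_in ?V) \<and> Y.basis ?cy n
      = (\<Sum>s\<in>?std n. term_xy s (e s)) + (\<Sum>m\<in>?mon n. scal (e m) (X.basis ?cx m))"
  proof (rule ballI, rule unitriangular_family.standard_spanning[OF X.unitriangular is_subring_polys_in])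
    fix n assume n: "n \<in> mingens (mons N)"
    show "coef (X.basis ?cx m) u \<in> polys_in ?V" for m u
      by (rule X.basis_coefficients[OF is_subring_polys_in])
        (auto intro: mvar_in_polys_in simp: edge_vars_def)
    show "coef (Y.basis ?cy n) u \<in> polys_in ?V" for u
      by (rule Y.basis_coefficients[OF is_subring_polys_in])
        (auto intro: mvar_in_polys_in simp: edge_vars_def)
    show "homogeneous_of \<alpha> \<beta> (deg \<alpha> \<beta> n) (Y.basis ?cy n)"
      unfolding homogeneous_of_def
      by (intro ballI unitriangular_family.same_degree[OF Y.unitriangular mingens_N[OF n]])
  qed
  from bchoice[OF this] obtain e where e_props: "\<forall>n\<in>mingens (mons N). (\<forall>u. e n u \<in> polys_in ?V) \<and>
      Y.basis ?cy n
      = (\<Sum>s\<in>?std n. term_xy s (e n s)) + (\<Sum>m\<in>?mon n. scal (e n m) (X.basis ?cx m))" ..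
  have e: "e n u \<in> polys_in ?V" if "n \<in> mingens (mons N)" for n u
    using bspec[OF e_props that] by (rule conjunct1[THEN spec])
  have normal_form: "Y.basis ?cy n
      = (\<Sum>s\<in>?std n. term_xy s (e n s)) + (\<Sum>m\<in>?mon n. scal (e n m) (X.basis ?cx m))"
    if "n \<in> mingens (mons N)" for n
    using bspec[OF e_props that] by (rule conjunct2)
  define F where "F n s = (if n \<in> mingens (mons N) then e n s else 0)" for n s
  have F: "F n s \<in> polys_in ?V" for n s
    using e by (simp add: F_def is_subringD(1)[OF is_subring_polys_in])
  let ?B = "{int_image (F n s) | n s. n \<in> mingens (mons N) \<and> s \<notin> mons M \<and> deg \<alpha> \<beta> s = deg \<alpha> \<beta> n}
    :: (evar, 'k) mpoly set"
  have points: "(\<forall>b\<in>?B. eval_mpoly (term_xy 0) t b \<in> \<aa>) \<longleftrightarrow>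
      t \<in> edge_points (term_xy 0) \<alpha> \<beta> H M N \<aa>"
    if \<aa>: "is_ideal \<aa>" for \<aa> :: "('z, 'k) mpoly set" and t
  proof -
    interpret \<phi>: ring_map "eval_mpoly of_int t :: (evar, int) mpoly \<Rightarrow> ('z, 'k) mpoly"
      by (rule ring_map.eval_ring_map[OF ring_map_of_int])
    interpret \<psi>: ring_map "eval_mpoly (term_xy 0) t :: (evar, 'k) mpoly \<Rightarrow> ('z, 'k) mpoly"
      by (rule ring_map.eval_ring_map[OF ring_map_const])
    let ?\<phi> = "eval_mpoly of_int t :: (evar, int) mpoly \<Rightarrow> ('z, 'k) mpoly"
    let ?tx = "\<lambda>a. t (Inl a)" and ?ty = "\<lambda>a. t (Inr a)"
    let ?I = "ideal_gen (X.basis ?tx ` mons M \<union> const_xy ` \<aa>)"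
    let ?I' = "ideal_gen (Y.basis ?ty ` mons N \<union> const_xy ` \<aa>)"
    note ideal = ideal_gen_is_ideal[of "X.basis ?tx ` mons M \<union> const_xy ` \<aa>"]
    have I: "pullback_ideal (eval_mpoly (term_xy 0) t) \<aa> (family_plus \<alpha> \<beta> (mons M)) = ?I"
      using X.pullback_family[OF \<psi>.ring_map_axioms, of \<aa> "\<lambda>a. mvar (Inl a)"]
      by (simp add: family_plus_def X.family_def ring_map.eval_mvar[OF ring_map_const])
    have I': "pullback_ideal (eval_mpoly (term_xy 0) t) \<aa> (family_minus \<alpha> \<beta> (mons N)) = ?I'"
      using Y.pullback_family[OF \<psi>.ring_map_axioms, of \<aa> "\<lambda>a. mvar (Inr a)"]
      by (simp add: family_minus_def Y.family_def ring_map.eval_mvar[OF ring_map_const])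
    have cells: "?I \<in> cell_points lex \<alpha> \<beta> H (mons M) \<aa>" "?I' \<in> cell_points lex_opp \<alpha> \<beta> H (mons N) \<aa>"
      using unitriangular_family.in_cell[OF X.unitriangular \<aa>] H_M
        unitriangular_family.in_cell[OF Y.unitriangular \<aa>] H_N by blast+
    have vanish_iff: "(\<forall>s\<in>?std n. ?\<phi> (F n s) \<in> \<aa>) \<longleftrightarrow> Y.basis ?ty n \<in> ?I"
      if n: "n \<in> mingens (mons N)" for n
    proof -
      have fin: "finite (?std n)"
        by (rule finite_subset[OF _ finite_degree[OF assms(1,2), of "deg \<alpha> \<beta> n"]]) auto
      \<comment> \<open>The specialised division.\<close>
      let ?nf = "\<Sum>s\<in>?std n. term_xy s (?\<phi> (F n s))"
      have "Y.basis ?ty n = Poly_Mapping.map ?\<phi> (Y.basis ?cy n)"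
        by (simp add: Y.map_basis[OF \<phi>.ring_map_axioms] ring_map.eval_mvar[OF ring_map_of_int])
      also have "\<dots> = ?nf + (\<Sum>m\<in>?mon n. scal (?\<phi> (e n m)) (X.basis ?tx m))"
        unfolding normal_form[OF n]
        by (simp add: F_def n \<phi>.map_plus \<phi>.map_sum \<phi>.map_times \<phi>.map_term
            X.map_basis[OF \<phi>.ring_map_axioms] ring_map.eval_mvar[OF ring_map_of_int])
      finally have nf: "Y.basis ?ty n = ?nf + (\<Sum>m\<in>?mon n. scal (?\<phi> (e n m)) (X.basis ?tx m))" .
      have red: "(\<Sum>m\<in>?mon n. scal (?\<phi> (e n m)) (X.basis ?tx m)) \<in> ?I"
        by (intro ideal_sum[OF ideal] ideal_mult[OF ideal] ideal_gen_base) auto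
      show ?thesis
      proof
        assume "\<forall>s\<in>?std n. ?\<phi> (F n s) \<in> \<aa>"
        then have "(\<Sum>s\<in>?std n. term_xy s 1 * const_xy (?\<phi> (F n s))) \<in> ?I"
          by (intro ideal_sum[OF ideal] ideal_mult[OF ideal] ideal_gen_base) auto
        from ideal_add[OF ideal this red] show "Y.basis ?ty n \<in> ?I"
          by (simp add: nf mult_single)
      next
        assume "Y.basis ?ty n \<in> ?I"
        from ideal_diff[OF ideal this red] have "?nf \<in> ?I" by (simp add: nf)
        moreover have "?std n \<inter> mons M = {}" by blast
        ultimately show "\<forall>s\<in>?std n. ?\<phi> (F n s) \<in> \<aa>"
          by (intro ballI unitriangular_family.standard_independent[OF X.unitriangular \<aa> fin])
      qed
    qed
    have specialise: "eval_mpoly (term_xy 0) t (int_image p :: (evar, 'k) mpoly) = ?\<phi> p" for p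
      by (rule eval_int_image)
    \<comment> \<open>Vanishing of all \<open>F n s\<close>, then of all normal forms, then inclusion and equality of the ideals.\<close>
    have "(\<forall>b\<in>?B. eval_mpoly (term_xy 0) t b \<in> \<aa>)
        \<longleftrightarrow> (\<forall>n\<in>mingens (mons N). \<forall>s\<in>?std n. ?\<phi> (F n s) \<in> \<aa>)"
      unfolding specialise[symmetric] by blast
    also have "\<dots> \<longleftrightarrow> (\<forall>n\<in>mingens (mons N). Y.basis ?ty n \<in> ?I)" using vanish_iff by simp
    also have "\<dots> \<longleftrightarrow> ?I' \<subseteq> ?I"
    proof
      assume "\<forall>n\<in>mingens (mons N). Y.basis ?ty n \<in> ?I"
      then show "?I' \<subseteq> ?I"
        unfolding Y.ideal_gen_family[symmetric] Y.family_eq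
        by (intro ideal_gen_minimal ideal) (auto intro: ideal_gen_base)
    next
      assume sub: "?I' \<subseteq> ?I"
      show "\<forall>n\<in>mingens (mons N). Y.basis ?ty n \<in> ?I"
        using mingens_N by (intro ballI subsetD[OF sub] ideal_gen_base) blast
    qed
    also have "\<dots> \<longleftrightarrow> ?I = ?I'"
      using cell_ideals_eq_of_subset[OF X.unitriangular Y.unitriangular \<aa>] H_M H_N by auto
    also have "\<dots> \<longleftrightarrow> t \<in> edge_points (term_xy 0) \<alpha> \<beta> H M N \<aa>"
      using cells by (simp add: edge_points_def I I')
    finally show ?thesis .
  qed
  have "?B \<subseteq> polys_in ?V" using int_image_in_polys_in[OF F] by auto
  then have "ideal_of_polys_in ?V (ideal_gen_in ?V ?B)" by (rule ideal_gen_in_is_ideal)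
  moreover have "(\<forall>p\<in>ideal_gen_in ?V ?B. eval_mpoly (term_xy 0) t p \<in> \<aa>) \<longleftrightarrow>
      t \<in> edge_points (term_xy 0) \<alpha> \<beta> H M N \<aa>"
    if \<aa>: "is_ideal \<aa>" for \<aa> :: "('z, 'k) mpoly set" and t
    using vanish_on_ideal_gen_in_iff[OF ring_map.eval_ring_map[OF ring_map_const] \<aa>] points[OF \<aa>]
    by (rule trans)
  ultimately have "is_edge_ideal TYPE('z) \<alpha> \<beta> H M N (ideal_gen_in ?V ?B)"
    unfolding is_edge_ideal_def by (intro conjI allI impI)
  with F show ?thesis by (intro exI[of _ F] conjI allI)
qed

end
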